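(* For every integer $n\ge1$, the orbicycle index polynomial of the symmetric group $S_n$ (acting on $[n]$) is $$P^{orb}_{S_{n}}(y_{1},y_{2},\dots,y_{n})=\sum_{\beta\vdash_{2}n}\left(\prod_{i\in[n]}\ \prod_{j\in[\alpha_i]}\frac{1}{j^{\beta(i,j)}\,\beta(i,j)!}\right)\prod_{k\in[n]}y_{k}^{\sum_{d\mid k}\beta\left(d,\frac{k}{d}\right)},$$ where for each $\beta\vdash_2 n$ one sets $\alpha_i=\sum_{j\ge1}j\,\beta(i,j)$.
   Context: $\mathbb{N}_+$ is the set of positive integers, $\mathbb{N}$ the set of nonnegative integers, $[k]=\{1,\dots,k\}$ (with $[0]=\emptyset$). A partition of depth $2$ of $n$, written $\beta\vdash_2 n$, is a map $\beta:\mathbb{N}_+\times\mathbb{N}_+\to\mathbb{N}$ such that $\sum_{(i,j)\in\mathbb{N}_+^2}ij\,\beta(i,j)=n$. For a finite group $G\subseteq S_m$: $C(G)$ is the set of conjugacy classes of $G$, with a fixed representative $g$ for each class $\overline{g}$, and $|\overline{g}|$ is the number of elements of the class; $Z(g)$ is the centralizer of $g$ in $G$; $P(G)=\{(\overline{g},h)\mid\overline{g}\in C(G),\ h\in Z(g)\}$. For $g\in S_m$, $C(g)$ denotes the partition of $[m]$ into the cycles (orbits, including fixed points) of $g$; $\pi\vee\rho$ is the join of partitions (the finest partition coarser than both); $b_k(\pi)$ is the number of blocks of $\pi$ of cardinality $k$. The orbicycle index polynomial of $G$ is $$P_{G}^{orb}(y_1,y_2,\dots)=\frac{1}{|G|}\sum_{(\overline{g},h)\in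 P(G)}|\overline{g}|\prod_{k\ge1}y_k^{b_k(C(g)\vee C(h))}\in\mathbb{Q}[y_1,y_2,\dots].$$ *)

theory Defs
  imports
    Complex_Main
    "HOL-Algebra.Sym_Groups"
    "HOL-Combinatorics.Orbits"
    "HOL-Library.Disjoint_Sets"
    "HOL-Library.Poly_Mapping"
begin

text \<open>A monomial is a finitely supported exponent map. The index 0 yields an additional
  indeterminate, which is never used.\<close>

type_synonym rat_mpoly = "(nat \<Rightarrow>\<^sub>0 nat) \<Rightarrow>\<^sub>0 rat"

definition mpoly_const :: "rat \<Rightarrow> rat_mpoly"
  where "mpoly_const c = Poly_Mapping.single 0 c"

definition mpoly_var :: "nat \<Rightarrow> rat_mpoly"
  where "mpoly_var k = Poly_Mapping.single (Poly_Mapping.single k 1) 1"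

definition conj_class :: "('a, 'b) monoid_scheme \<Rightarrow> 'a \<Rightarrow> 'a set"
  where "conj_class G g = {x \<otimes>\<^bsub>G\<^esub> g \<otimes>\<^bsub>G\<^esub> inv\<^bsub>G\<^esub> x | x. x \<in> carrier G}"

definition conj_classes :: "('a, 'b) monoid_scheme \<Rightarrow> 'a set set"
  where "conj_classes G = conj_class G ` carrier G"

definition centralizer :: "('a, 'b) monoid_scheme \<Rightarrow> 'a \<Rightarrow> 'a set"
  where "centralizer G g = {h \<in> carrier G. h \<otimes>\<^bsub>G\<^esub> g = g \<otimes>\<^bsub>G\<^esub> h}"

definition class_representatives :: "('a, 'b) monoid_scheme \<Rightarrow> ('a set \<Rightarrow> 'a) \<Rightarrow> bool"
  where "class_representatives G rep \<longleftrightarrow> (\<forall>c \<in> conj_classes G. rep c \<in> c)"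

definition class_centralizer_pairs ::
    "('a, 'b) monoid_scheme \<Rightarrow> ('a set \<Rightarrow> 'a) \<Rightarrow> ('a set \<times> 'a) set"
  where "class_centralizer_pairs G rep = (SIGMA c : conj_classes G. centralizer G (rep c))"

text \<open>\<open>Orbits.orbit g x\<close> consists of the iterates \<open>(g ^^ k) x\<close> with \<open>k > 0\<close>; for a permutation
  of a finite set it contains \<open>x\<close>, so that a fixed point gives a singleton block.\<close>

definition cycle_partition :: "nat \<Rightarrow> (nat \<Rightarrow> nat) \<Rightarrow> nat set set"
  where "cycle_partition m g = Orbits.orbit g ` {1..m}"

definition is_partition_join :: "'a set \<Rightarrow> 'a set set \<Rightarrow> 'a set set \<Rightarrow> 'a set set \<Rightarrow> bool"
  where "is_partition_join A P Q R \<longleftrightarrow>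
    refines A P R \<and> refines A Q R \<and>
    (\<forall>S. refines A P S \<and> refines A Q S \<longrightarrow> refines A R S)"

definition partition_join :: "'a set \<Rightarrow> 'a set set \<Rightarrow> 'a set set \<Rightarrow> 'a set set"
  where "partition_join A P Q = (THE R. is_partition_join A P Q R)"

lemma ex1_partition_join:
  assumes P: "partition_on A P" and Q: "partition_on A Q"
  shows "\<exists>!R. is_partition_join A P Q R"
proof -
  let ?U = "{S. refines A P S \<and> refines A Q S}"
  have part: "partition_on A S" if "S \<in> ?U" for S
    using that by (auto simp: refines_def)
  have "{A} - {{}} \<in> ?U"
  proof -
    have "partition_on A ({A} - {{}})"
      by (auto simp: partition_on_def disjoint_def)
    moreover have "X \<subseteq> A \<and> A \<noteq> {}" if "X \<in> P \<or> X \<in> Q" for X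
      using that P Q by (auto simp: partition_on_def)
    ultimately show ?thesis
      using P Q by (auto simp: refines_def)
  qed
  then have ne: "?U \<noteq> {}"
    by blast
  have "refines A P (common_refinement ?U)" "refines A Q (common_refinement ?U)"
    by (rule common_refinement_coarsest; use part P Q ne in auto)+
  moreover have "refines A (common_refinement ?U) S" if "S \<in> ?U" for S
    by (rule refines_common_refinement) (use part that in auto)
  ultimately have "is_partition_join A P Q (common_refinement ?U)"
    by (simp add: is_partition_join_def)
  moreover have "R = R'" if "is_partition_join A P Q R" "is_partition_join A P Q R'" for R R'
    by (rule refines_asym[of A]) (use that in \<open>simp_all add: is_partition_join_def\<close>)
  ultimately show ?thesis
    by blast
qed

definition num_blocks :: "nat \<Rightarrow> 'a set set \<Rightarrow> nat"
  where "num_blocks k P = card {B \<in> P. card B = k}"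

text \<open>\<open>G\<close> is meant to be a group of permutations of \<open>{1..m}\<close>. Blocks of a partition of \<open>{1..m}\<close>
  have size between 1 and \<open>m\<close>, so the product over all \<open>k \<ge> 1\<close> is the one over \<open>{1..m}\<close>.\<close>

definition orbicycle_index ::
    "nat \<Rightarrow> (nat \<Rightarrow> nat) monoid \<Rightarrow> ((nat \<Rightarrow> nat) set \<Rightarrow> (nat \<Rightarrow> nat)) \<Rightarrow> rat_mpoly"
  where "orbicycle_index m G rep =
    mpoly_const (1 / of_nat (order G)) *
    (\<Sum>(c, h) \<in> class_centralizer_pairs G rep.
       mpoly_const (of_nat (card c)) *
       (\<Prod>k \<in> {1..m}. mpoly_var k ^ num_blocks k
          (partition_join {1..m} (cycle_partition m (rep c)) (cycle_partition m h))))"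

text \<open>A map on pairs of positive integers is represented by its extension by zero. Finiteness of
  the support is what it means for the sum of the values \<open>i * j * \<beta> (i, j)\<close> to be a natural
  number; it has to be required since \<open>sum\<close> yields 0 on infinite sets.\<close>

definition depth2_partition :: "nat \<Rightarrow> (nat \<times> nat \<Rightarrow> nat) \<Rightarrow> bool"
  where "depth2_partition n \<beta> \<longleftrightarrow>
    (\<forall>i j. i = 0 \<or> j = 0 \<longrightarrow> \<beta> (i, j) = 0) \<and>
    finite {p. \<beta> p \<noteq> 0} \<and>
    (\<Sum>(i, j) | \<beta> (i, j) \<noteq> 0. i * j * \<beta> (i, j)) = n"

definition depth2_alpha :: "(nat \<times> nat \<Rightarrow> nat) \<Rightarrow> nat \<Rightarrow> nat"
  where "depth2_alpha \<beta> i = (\<Sum>j | j \<ge> 1 \<and> \<beta> (i, j) \<noteq> 0. j * \<beta> (i, j))"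

lemma depth2_partition_le:
  assumes "depth2_partition n \<beta>" and nz: "\<beta> (i, j) \<noteq> 0"
  shows "i \<le> n" "j \<le> n" "\<beta> (i, j) \<le> n"
proof -
  have pos: "\<And>i j. i = 0 \<or> j = 0 \<Longrightarrow> \<beta> (i, j) = 0" and fin: "finite {p. \<beta> p \<noteq> 0}"
    and sum: "(\<Sum>(i, j) | \<beta> (i, j) \<noteq> 0. i * j * \<beta> (i, j)) = n"
    using assms by (auto simp: depth2_partition_def)
  have i: "i > 0" and j: "j > 0" and b: "\<beta> (i, j) > 0"
    using pos[of i j] nz by (metis neq0_conv)+
  have fin': "finite {(i, j). \<beta> (i, j) \<noteq> 0}"
    by (rule finite_subset[OF _ fin]) auto
  have "(case (i, j) of (i, j) \<Rightarrow> i * j * \<beta> (i, j))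
      \<le> (\<Sum>(i, j) | \<beta> (i, j) \<noteq> 0. i * j * \<beta> (i, j))"
    by (rule member_le_sum) (use fin' nz in auto)
  then have le: "i * j * \<beta> (i, j) \<le> n"
    using sum by simp
  have "i dvd i * j * \<beta> (i, j)" "j dvd i * j * \<beta> (i, j)" "\<beta> (i, j) dvd i * j * \<beta> (i, j)"
    by simp_all
  moreover have "0 < i * j * \<beta> (i, j)"
    using i j b by simp
  ultimately show "i \<le> n" "j \<le> n" "\<beta> (i, j) \<le> n"
    using le by (meson dvd_imp_le le_trans)+
qed

lemma finite_depth2_partitions: "finite {\<beta>. depth2_partition n \<beta>}"
proof (rule finite_subset)
  let ?S = "{\<beta> :: nat \<times> nat \<Rightarrow> nat. \<forall>p. (p \<in> {..n} \<times> {..n} \<longrightarrow> \<beta> p \<in> {..n}) \<and>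
    (p \<notin> {..n} \<times> {..n} \<longrightarrow> \<beta> p = 0)}"
  have "\<beta> p \<le> n" "p \<notin> {..n} \<times> {..n} \<Longrightarrow> \<beta> p = 0" if "depth2_partition n \<beta>" for \<beta> p
    using depth2_partition_le[OF that, of "fst p" "snd p"]
    by (cases "\<beta> p = 0"; simp add: mem_Times_iff)+
  then show "{\<beta>. depth2_partition n \<beta>} \<subseteq> ?S"
    by blast
  show "finite ?S"
    by (rule finite_set_of_finite_funs) simp_all
qed

end

theory Submission
  imports Defs
begin

text \<open>
  The join of the cycle partitions of two commuting permutations \<open>g\<close> and \<open>h\<close> is the partition into the
  orbits of the group that they generate (\<open>partition_join_cycle_partitions\<close>). The weight of a pair is
  therefore the product of \<open>y\<^sub>k\<close> over these orbits, where \<open>k\<close> is the size of the orbit. It does not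
  change under simultaneous conjugation, so the factor \<open>|c|\<close> turns the sum over class representatives
  into a sum over all commuting pairs (\<open>sum_class_centralizer_pairs\<close>), and the polynomial is \<open>F(n) / n!\<close>,
  where \<open>F(n)\<close> is the sum of the weights of all commuting pairs of permutations of \<open>n\<close> points.

  Splitting off the orbit \<open>B\<close> of one fixed point expresses \<open>F(n)\<close> by the values \<open>F(n - k)\<close>, where \<open>k = |B|\<close>,
  and by the number of transitive commuting pairs on \<open>B\<close> (\<open>commuting_weight_sum_rec\<close>). Such a pair winds a
  rectangular grid of width \<open>i\<close> and height \<open>j\<close> around \<open>B\<close>, where \<open>i j = k\<close>: \<open>g\<close> turns each row cyclically, \<open>h\<close>
  climbs to the next row, and climbing from the last row leads back to the first, shifted by some
  \<open>s < i\<close>. There are \<open>i\<close> shifts for each \<open>i\<close>, and \<open>(k - 1)!\<close> ways to label \<open>B\<close> by the grid once the origin is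
  fixed. Hence there are \<open>\<sigma>(k) (k - 1)!\<close> transitive pairs, where \<open>\<sigma>(k)\<close> is the sum of the divisors of \<open>k\<close>
  (\<open>card_transitive_commuting_perms\<close>). It follows that \<open>R(n) = F(n) / n!\<close> satisfies \<open>R(0) = 1\<close> and
  \<open>n R(n) = \<Sum>\<^bsub>k=1..n\<^esub> \<sigma>(k) y\<^sub>k R(n - k)\<close>, which determines \<open>R\<close> (\<open>commuting_weight_sum_eq\<close>).

  The sum over partitions of depth 2 satisfies the same recurrence (\<open>depth2_weight_sum_rec\<close>). Here
  \<open>\<beta>(i, j)\<close> counts the orbits that are wound by a grid of width \<open>i\<close> and height \<open>j\<close>; lowering this entry by
  one turns \<open>i j \<beta>(i, j)\<close> times the weight of \<open>\<beta>\<close> into \<open>i y\<^bsub>ij\<^esub>\<close> times the weight of the smaller partition,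
  and \<open>\<sigma>(k)\<close> is the sum of \<open>i\<close> over all \<open>i j = k\<close>.
\<close>

section \<open>Joint orbits of commuting permutations\<close>

definition commuting_perms :: "'a set \<Rightarrow> (('a \<Rightarrow> 'a) \<times> ('a \<Rightarrow> 'a)) set"
  where "commuting_perms A = {(g, h). g permutes A \<and> h permutes A \<and> g \<circ> h = h \<circ> g}"

text \<open>For commuting permutations of a finite set this is the orbit of \<open>a\<close> under the group generated by
  \<open>g\<close> and \<open>h\<close>: a word in \<open>g\<close> and \<open>h\<close> can be sorted, and inverses are nonnegative powers.\<close>

definition joint_orbit :: "('a \<Rightarrow> 'a) \<Rightarrow> ('a \<Rightarrow> 'a) \<Rightarrow> 'a \<Rightarrow> 'a set"
  where "joint_orbit g h a = {(h ^^ y) ((g ^^ x) a) | x y. True}"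

lemma funpow_swap:
  assumes "g \<circ> h = h \<circ> g"
  shows "(g ^^ x) ((h ^^ y) z) = (h ^^ y) ((g ^^ x) z)"
proof -
  have 1: "g (h z) = h (g z)" for z
    using assms by (metis comp_apply)
  have 2: "g ((h ^^ y) z) = (h ^^ y) (g z)" for z
    by (induction y) (simp_all add: 1)
  show ?thesis
    by (induction x) (simp_all add: 2)
qed

lemma finite_commuting_perms: "finite A \<Longrightarrow> finite (commuting_perms A)"
  by (rule finite_subset[of _ "{p. p permutes A} \<times> {p. p permutes A}"])
     (auto simp: commuting_perms_def finite_permutations)

lemma joint_orbit_self: "a \<in> joint_orbit g h a"
  unfolding joint_orbit_def by (auto intro!: exI[of _ 0])

lemma joint_orbit_least:
  assumes "a \<in> S" "\<And>z. z \<in> S \<Longrightarrow> g z \<in> S" "\<And>z. z \<in> S \<Longrightarrow> h z \<in> S"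
  shows "joint_orbit g h a \<subseteq> S"
proof -
  have 1: "(g ^^ x) a \<in> S" for x
    by (induction x) (auto simp: assms)
  have "(h ^^ y) ((g ^^ x) a) \<in> S" for x y
    by (induction y) (auto simp: assms 1)
  then show ?thesis
    by (auto simp: joint_orbit_def)
qed

lemma joint_orbit_step:
  assumes "g \<circ> h = h \<circ> g" "z \<in> joint_orbit g h a"
  shows "g z \<in> joint_orbit g h a" "h z \<in> joint_orbit g h a"
proof -
  obtain x y where z: "z = (h ^^ y) ((g ^^ x) a)"
    using assms by (auto simp: joint_orbit_def)
  have "g z = (h ^^ y) ((g ^^ Suc x) a)"
    using funpow_swap[OF assms(1), of 1] by (simp add: z)
  then show "g z \<in> joint_orbit g h a"
    unfolding joint_orbit_def by blast
  have "h z = (h ^^ Suc y) ((g ^^ x) a)"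
    by (simp add: z)
  then show "h z \<in> joint_orbit g h a"
    unfolding joint_orbit_def by blast
qed

lemma joint_orbit_subset:
  assumes "(g, h) \<in> commuting_perms A" "a \<in> A"
  shows "joint_orbit g h a \<subseteq> A"
  using assms by (intro joint_orbit_least) (auto simp: commuting_perms_def permutes_in_image)

text \<open>A permutation that maps a finite set into itself maps it onto itself, so it cannot carry an outside
  point into it. This takes the place of closure under inverses.\<close>

lemma permutes_invariant_iff:
  assumes "g permutes A" "finite A" "S \<subseteq> A" "\<And>z. z \<in> S \<Longrightarrow> g z \<in> S"
  shows "g z \<in> S \<longleftrightarrow> z \<in> S"
proof -
  have "g ` S = S"
    using assms by (intro endo_inj_surj) (auto intro: permutes_inj_on finite_subset)
  then show ?thesis
    using permutes_inj[OF assms(1)] by (metis inj_image_mem_iff)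
qed

lemma joint_orbit_step_iff:
  assumes "(g, h) \<in> commuting_perms A" "finite A" "a \<in> A"
  shows "g z \<in> joint_orbit g h a \<longleftrightarrow> z \<in> joint_orbit g h a"
    and "h z \<in> joint_orbit g h a \<longleftrightarrow> z \<in> joint_orbit g h a"
proof -
  have "g permutes A" "h permutes A" "g \<circ> h = h \<circ> g"
    using assms by (auto simp: commuting_perms_def)
  then show "g z \<in> joint_orbit g h a \<longleftrightarrow> z \<in> joint_orbit g h a"
    and "h z \<in> joint_orbit g h a \<longleftrightarrow> z \<in> joint_orbit g h a"
    using assms(2) joint_orbit_subset[OF assms(1,3)] joint_orbit_step[of g h]
    by (intro permutes_invariant_iff; blast)+
qed

text \<open>Orbits are disjoint or equal because the complement of the orbit of \<open>b\<close> is closed under \<open>g\<close> and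
  \<open>h\<close>: if it contained \<open>a\<close>, it would contain the whole orbit of \<open>a\<close>, and with it \<open>b\<close>.\<close>

lemma joint_orbit_eq:
  assumes "(g, h) \<in> commuting_perms A" "finite A" "a \<in> A" "b \<in> joint_orbit g h a"
  shows "joint_orbit g h b = joint_orbit g h a"
proof
  have comm: "g \<circ> h = h \<circ> g"
    using assms by (simp add: commuting_perms_def)
  show "joint_orbit g h b \<subseteq> joint_orbit g h a"
    using assms joint_orbit_step[OF comm] by (intro joint_orbit_least)
  have b: "b \<in> A"
    using joint_orbit_subset[OF assms(1,3)] assms(4) by (rule subsetD)
  note iff = joint_orbit_step_iff[OF assms(1,2) b]
  have "a \<in> joint_orbit g h b"
  proof (rule ccontr)
    assume "a \<notin> joint_orbit g h b"
    then have "joint_orbit g h a \<subseteq> - joint_orbit g h b"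
      by (intro joint_orbit_least) (auto simp: iff)
    then show False
      using assms(4) joint_orbit_self[of b g h] by blast
  qed
  then show "joint_orbit g h a \<subseteq> joint_orbit g h b"
    using joint_orbit_step[OF comm] by (intro joint_orbit_least)
qed

lemma partition_on_joint_orbits:
  assumes "(g, h) \<in> commuting_perms A" "finite A"
  shows "partition_on A (joint_orbit g h ` A)"
proof (rule partition_onI)
  show "\<Union> (joint_orbit g h ` A) = A"
    using joint_orbit_subset[OF assms(1)] joint_orbit_self by fast
  show "{} \<notin> joint_orbit g h ` A"
    using joint_orbit_self by fast
  show "disjnt p q" if "p \<in> joint_orbit g h ` A" "q \<in> joint_orbit g h ` A" "p \<noteq> q" for p q
  proof -
    obtain a b where "a \<in> A" "p = joint_orbit g h a" "b \<in> A" "q = joint_orbit g h b"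
      using \<open>p \<in> _\<close> \<open>q \<in> _\<close> by blast
    then show ?thesis
      using joint_orbit_eq[OF assms] \<open>p \<noteq> q\<close> unfolding disjnt_iff by metis
  qed
qed

text \<open>A permutation commutes with the identity, so its cycles are joint orbits too, and the facts on
  joint orbits apply to cycle partitions.\<close>

lemma cycle_partition_eq_joint_orbits:
  assumes "g permutes {1..n}"
  shows "cycle_partition n g = joint_orbit g id ` {1..n}"
    and "cycle_partition n g = joint_orbit id g ` {1..n}"
proof -
  have "permutation g"
    using assms by (auto simp: permutation_permutes)
  then show "cycle_partition n g = joint_orbit g id ` {1..n}"
    and "cycle_partition n g = joint_orbit id g ` {1..n}"
    by (simp_all add: cycle_partition_def joint_orbit_def orbit_altdef_permutation)
qed

text \<open>The orbits of the group generated by \<open>g\<close> and \<open>h\<close> are unions of cycles of either permutation. They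
  form the finest such partition, since a block of any partition coarser than both cycle partitions
  is closed under \<open>g\<close> and \<open>h\<close> and therefore contains the orbits that it meets.\<close>

lemma partition_join_cycle_partitions:
  assumes gh: "(g, h) \<in> commuting_perms {1..n}"
  shows "partition_join {1..n} (cycle_partition n g) (cycle_partition n h) = joint_orbit g h ` {1..n}"
proof -
  let ?A = "{1..n}" and ?R = "joint_orbit g h ` {1..n}"
  have g: "g permutes ?A" and h: "h permutes ?A" and comm: "g \<circ> h = h \<circ> g"
    using gh by (auto simp: commuting_perms_def)
  have "(g, id) \<in> commuting_perms ?A" "(id, h) \<in> commuting_perms ?A"
    using g h by (auto simp: commuting_perms_def permutes_id)
  then have pg: "partition_on ?A (cycle_partition n g)" and ph: "partition_on ?A (cycle_partition n h)"
    using partition_on_joint_orbits[of _ _ ?A] cycle_partition_eq_joint_orbits(1)[OF g]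
      cycle_partition_eq_joint_orbits(2)[OF h] by simp_all
  have pR: "partition_on ?A ?R"
    using partition_on_joint_orbits[OF gh] by simp
  have "joint_orbit g id a \<subseteq> joint_orbit g h a" "joint_orbit id h a \<subseteq> joint_orbit g h a" for a
    by (rule joint_orbit_least; simp add: joint_orbit_self joint_orbit_step[OF comm])+
  then have "refines ?A (cycle_partition n g) ?R" "refines ?A (cycle_partition n h) ?R"
    using pg ph pR unfolding refines_def cycle_partition_eq_joint_orbits(1)[OF g]
      cycle_partition_eq_joint_orbits(2)[OF h] by blast+
  moreover have "refines ?A ?R S"
    if "refines ?A (cycle_partition n g) S" "refines ?A (cycle_partition n h) S" for S
  proof -
    have pS: "partition_on ?A S"
      using that by (simp add: refines_def)
    \<comment> \<open>a block of \<open>S\<close> contains the cycles of \<open>g\<close> and of \<open>h\<close> through each of its points\<close>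
    have closed: "g z \<in> Y \<and> h z \<in> Y" if "Y \<in> S" "z \<in> Y" for Y z
    proof -
      have z: "z \<in> ?A"
        using that pS by (auto simp: partition_on_def)
      have uniq: "Y' = Y" if "Y' \<in> S" "z \<in> Y'" for Y'
        using that \<open>Y \<in> S\<close> \<open>z \<in> Y\<close> pS unfolding partition_on_def disjoint_def by blast
      have "joint_orbit g id z \<subseteq> Y" "joint_orbit id h z \<subseteq> Y"
        using \<open>refines ?A (cycle_partition n g) S\<close> \<open>refines ?A (cycle_partition n h) S\<close> z
          joint_orbit_self uniq
        unfolding refines_def cycle_partition_eq_joint_orbits(1)[OF g]
          cycle_partition_eq_joint_orbits(2)[OF h] by (metis imageI subsetD)+
      then show ?thesis
        using joint_orbit_step[of g id z z] joint_orbit_step[of id h z z] joint_orbit_self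
        by (metis comp_id id_comp subsetD)
    qed
    have "\<exists>Y\<in>S. joint_orbit g h a \<subseteq> Y" if "a \<in> ?A" for a
    proof -
      have "a \<in> \<Union>S"
        using pS that by (simp add: partition_on_def)
      then obtain Y where Y: "Y \<in> S" "a \<in> Y" ..
      have "joint_orbit g h a \<subseteq> Y"
        using Y(2) by (rule joint_orbit_least) (simp_all add: closed[OF Y(1)])
      then show ?thesis
        using Y(1) ..
    qed
    then show ?thesis
      using pR pS by (auto simp: refines_def)
  qed
  ultimately have "is_partition_join ?A (cycle_partition n g) (cycle_partition n h) ?R"
    by (simp add: is_partition_join_def)
  then show ?thesis
    unfolding partition_join_def using ex1_partition_join[OF pg ph] by (rule the1_equality[rotated])
qed

section \<open>Splitting off one orbit\<close>

text \<open>For \<open>a \<in> B\<close> these are the pairs that generate a transitive group on \<open>B\<close>; which point of \<open>B\<close> is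
  taken for \<open>a\<close> makes no difference.\<close>

definition transitive_commuting_perms :: "'a \<Rightarrow> 'a set \<Rightarrow> (('a \<Rightarrow> 'a) \<times> ('a \<Rightarrow> 'a)) set"
  where "transitive_commuting_perms a B = {(g, h) \<in> commuting_perms B. joint_orbit g h a = B}"

definition orbit_weight ::
    "(nat \<Rightarrow> 'r) \<Rightarrow> 'a set \<Rightarrow> ('a \<Rightarrow> 'a) \<Rightarrow> ('a \<Rightarrow> 'a) \<Rightarrow> 'r::comm_semiring_1"
  where "orbit_weight y A g h = (\<Prod>B \<in> joint_orbit g h ` A. y (card B))"

definition commuting_weight_sum :: "(nat \<Rightarrow> 'r) \<Rightarrow> 'a set \<Rightarrow> 'r::comm_semiring_1"
  where "commuting_weight_sum y A = (\<Sum>(g, h) \<in> commuting_perms A. orbit_weight y A g h)"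

lemma finite_transitive_commuting_perms:
  "finite B \<Longrightarrow> finite (transitive_commuting_perms a B)"
  by (rule finite_subset[OF _ finite_commuting_perms[of B]])
     (auto simp: transitive_commuting_perms_def)

text \<open>An orbit sees only the values of the two maps on a closed set around its starting point, so it
  does not change when a pair is restricted to, or extended from, a union of orbits.\<close>

lemma joint_orbit_cong:
  assumes "a \<in> S" and "\<And>z. z \<in> S \<Longrightarrow> g z \<in> S \<and> h z \<in> S"
    and "\<And>z. z \<in> S \<Longrightarrow> g' z = g z" "\<And>z. z \<in> S \<Longrightarrow> h' z = h z"
  shows "joint_orbit g' h' a = joint_orbit g h a"
proof -
  have 1: "(g' ^^ x) a = (g ^^ x) a \<and> (g ^^ x) a \<in> S" for x
    by (induction x) (simp_all add: assms)
  have "(h' ^^ y) ((g' ^^ x) a) = (h ^^ y) ((g ^^ x) a) \<and> (h ^^ y) ((g ^^ x) a) \<in> S" for x y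
    by (induction y) (simp_all add: assms 1)
  then show ?thesis
    by (simp add: joint_orbit_def)
qed

lemma permutes_restrict:
  assumes "g permutes A" "finite A" "S \<subseteq> A" "\<And>z. z \<in> S \<Longrightarrow> g z \<in> S"
  shows "perm_restrict g S permutes S"
proof (rule bij_imp_permutes)
  have inj: "inj_on g S"
    using assms(1) by (rule permutes_inj_on)
  have "finite S"
    using assms(2,3) by (rule finite_subset[rotated])
  then have "g ` S = S"
    using assms(4) inj by (intro endo_inj_surj) auto
  then have "bij_betw g S S"
    using inj by (simp add: bij_betw_def)
  then show "bij_betw (perm_restrict g S) S S"
    by (rule bij_betw_cong[THEN iffD1, rotated]) (simp add: perm_restrict_simps)
qed (simp add: perm_restrict_simps)

lemma commuting_perms_restrict:
  assumes "(g, h) \<in> commuting_perms A" "finite A" "S \<subseteq> A"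
    and closed: "\<And>z. z \<in> S \<Longrightarrow> g z \<in> S" "\<And>z. z \<in> S \<Longrightarrow> h z \<in> S"
  shows "(perm_restrict g S, perm_restrict h S) \<in> commuting_perms S"
proof -
  have g: "g permutes A" and h: "h permutes A" and comm: "g (h z) = h (g z)" for z
    using assms(1) by (auto simp: commuting_perms_def fun_eq_iff)
  have "perm_restrict g S \<circ> perm_restrict h S = perm_restrict h S \<circ> perm_restrict g S"
    using closed comm by (auto simp: fun_eq_iff perm_restrict_def)
  then show ?thesis
    using permutes_restrict[OF g assms(2,3) closed(1)] permutes_restrict[OF h assms(2,3) closed(2)]
    by (simp add: commuting_perms_def)
qed

lemma comp_disjoint_perms:
  assumes "p permutes B" "q permutes A - B"
  shows "z \<in> B \<Longrightarrow> (p \<circ> q) z = p z" and "z \<notin> B \<Longrightarrow> (p \<circ> q) z = q z" and "q z \<in> B \<longleftrightarrow> z \<in> B"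
proof -
  show q: "q z \<in> B \<longleftrightarrow> z \<in> B"
    using assms(2) permutes_in_image[OF assms(2), of z] by (metis DiffE permutes_not_in)
  show "(p \<circ> q) z = p z" if "z \<in> B"
    using permutes_not_in[OF assms(2), of z] that by simp
  show "(p \<circ> q) z = q z" if "z \<notin> B"
    using permutes_not_in[OF assms(1), of "q z"] q that by simp
qed

lemma commuting_perms_union:
  assumes "B \<subseteq> A" "(g1, h1) \<in> commuting_perms B" "(g2, h2) \<in> commuting_perms (A - B)"
  shows "(g1 \<circ> g2, h1 \<circ> h2) \<in> commuting_perms A"
proof -
  have p: "g1 permutes B" "h1 permutes B" "g2 permutes A - B" "h2 permutes A - B"
    and c: "g1 (h1 z) = h1 (g1 z)" "g2 (h2 z) = h2 (g2 z)" for z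
    using assms by (auto simp: commuting_perms_def fun_eq_iff)
  have "g1 permutes A" "h1 permutes A" "g2 permutes A" "h2 permutes A"
    using p assms(1) by (auto intro: permutes_subset)
  moreover have "((g1 \<circ> g2) \<circ> (h1 \<circ> h2)) z = ((h1 \<circ> h2) \<circ> (g1 \<circ> g2)) z" for z
  proof (cases "z \<in> B")
    case True
    then have "g1 z \<in> B" "h1 z \<in> B"
      using p by (simp_all add: permutes_in_image)
    then show ?thesis
      using True comp_disjoint_perms(1)[OF p(1,3)] comp_disjoint_perms(1)[OF p(2,4)] c
      by (metis comp_apply)
  next
    case False
    then have "g2 z \<notin> B" "h2 z \<notin> B"
      using comp_disjoint_perms(3)[OF p(1,3)] comp_disjoint_perms(3)[OF p(2,4)] by simp_all
    then show ?thesis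
      using False comp_disjoint_perms(2)[OF p(1,3)] comp_disjoint_perms(2)[OF p(2,4)] c
      by (metis comp_apply)
  qed
  ultimately show ?thesis
    by (auto simp: commuting_perms_def permutes_compose)
qed

lemma orbit_weight_union:
  assumes "a \<in> B" "B \<subseteq> A" "finite A"
    and t: "(g1, h1) \<in> transitive_commuting_perms a B" and c: "(g2, h2) \<in> commuting_perms (A - B)"
  shows "joint_orbit (g1 \<circ> g2) (h1 \<circ> h2) a = B"
    and "orbit_weight y A (g1 \<circ> g2) (h1 \<circ> h2) = y (card B) * orbit_weight y (A - B) g2 h2"
proof -
  have t': "(g1, h1) \<in> commuting_perms B" "joint_orbit g1 h1 a = B"
    using t by (auto simp: transitive_commuting_perms_def)
  have p: "g1 permutes B" "h1 permutes B" "g2 permutes A - B" "h2 permutes A - B"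
    using t' c by (auto simp: commuting_perms_def)
  have "joint_orbit (g1 \<circ> g2) (h1 \<circ> h2) z = joint_orbit g1 h1 z" if "z \<in> B" for z
    using that by (rule joint_orbit_cong)
      (use p in \<open>simp_all add: permutes_in_image comp_disjoint_perms(1) del: comp_apply\<close>)
  moreover have "joint_orbit g1 h1 z = B" if "z \<in> B" for z
    using joint_orbit_eq[OF t'(1) _ assms(1), of z] t'(2) that assms(2,3) finite_subset by metis
  ultimately have B: "joint_orbit (g1 \<circ> g2) (h1 \<circ> h2) z = B" if "z \<in> B" for z
    using that by simp
  then show "joint_orbit (g1 \<circ> g2) (h1 \<circ> h2) a = B"
    using assms(1) by simp
  have AB: "joint_orbit (g1 \<circ> g2) (h1 \<circ> h2) z = joint_orbit g2 h2 z" if "z \<in> A - B" for z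
    using that by (rule joint_orbit_cong)
      (use p in \<open>simp_all add: permutes_in_image comp_disjoint_perms(2) del: comp_apply Diff_iff\<close>,
       auto simp: comp_disjoint_perms(2) simp del: comp_apply)
  have "A = B \<union> (A - B)"
    using assms(2) by blast
  then have "joint_orbit (g1 \<circ> g2) (h1 \<circ> h2) ` A
      = joint_orbit (g1 \<circ> g2) (h1 \<circ> h2) ` B \<union> joint_orbit (g1 \<circ> g2) (h1 \<circ> h2) ` (A - B)"
    by (metis image_Un)
  also have "joint_orbit (g1 \<circ> g2) (h1 \<circ> h2) ` B = {B}"
    using B assms(1) by auto
  also have "joint_orbit (g1 \<circ> g2) (h1 \<circ> h2) ` (A - B) = joint_orbit g2 h2 ` (A - B)"
    using AB by (rule image_cong[OF refl])
  finally have "joint_orbit (g1 \<circ> g2) (h1 \<circ> h2) ` A = insert B (joint_orbit g2 h2 ` (A - B))"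
    by (simp only: insert_is_Un[symmetric])
  moreover have "B \<notin> joint_orbit g2 h2 ` (A - B)"
    using joint_orbit_subset[OF c] assms(1) by blast
  ultimately show "orbit_weight y A (g1 \<circ> g2) (h1 \<circ> h2) = y (card B) * orbit_weight y (A - B) g2 h2"
    using assms(3) unfolding orbit_weight_def by (simp del: comp_apply)
qed

text \<open>Let \<open>B\<close> be the orbit of \<open>a\<close>. A commuting pair on \<open>A\<close> is the same as its restrictions to \<open>B\<close>, which
  form a transitive pair, and to \<open>A - B\<close>, which form an arbitrary commuting pair. The orbits other
  than \<open>B\<close> are those of the second restriction.\<close>

lemma commuting_weight_sum_rec:
  assumes "finite A" "a \<in> A"
  shows "commuting_weight_sum y A = (\<Sum>B | a \<in> B \<and> B \<subseteq> A.
    of_nat (card (transitive_commuting_perms a B)) * y (card B) * commuting_weight_sum y (A - B))"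
proof -
  let ?T = "SIGMA B:{B. a \<in> B \<and> B \<subseteq> A}. transitive_commuting_perms a B \<times> commuting_perms (A - B)"
  let ?split = "\<lambda>(g, h). (joint_orbit g h a,
      (perm_restrict g (joint_orbit g h a), perm_restrict h (joint_orbit g h a)),
      (perm_restrict g (A - joint_orbit g h a), perm_restrict h (A - joint_orbit g h a)))"
  let ?join = "\<lambda>(B, (g1, h1), (g2, h2)). (g1 \<circ> g2, h1 \<circ> h2)"
  let ?w = "\<lambda>(B, (g1, h1), (g2, h2)). y (card B) * orbit_weight y (A - B) g2 h2"
  have "commuting_weight_sum y A = sum ?w ?T"
    unfolding commuting_weight_sum_def
  proof (rule sum.reindex_bij_witness[of _ ?join ?split])
    fix gh
    assume "gh \<in> commuting_perms A"
    then obtain g h where gh: "gh = (g, h)" and c: "(g, h) \<in> commuting_perms A"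
      by (cases gh) auto
    let ?B = "joint_orbit g h a"
    have p: "g permutes A" "h permutes A"
      using c by (auto simp: commuting_perms_def)
    have sub: "?B \<subseteq> A"
      using joint_orbit_subset[OF c assms(2)] .
    note iff = joint_orbit_step_iff[OF c assms]
    have *: "perm_restrict f ?B \<circ> perm_restrict f (A - ?B) = f"
      if "f permutes A" "\<And>z. f z \<in> ?B \<longleftrightarrow> z \<in> ?B" for f
      using that permutes_not_in[OF that(1)] sub by (auto simp: fun_eq_iff perm_restrict_def)
    have g: "perm_restrict g ?B \<circ> perm_restrict g (A - ?B) = g"
      and h: "perm_restrict h ?B \<circ> perm_restrict h (A - ?B) = h"
      using *[OF p(1)] *[OF p(2)] iff by simp_all
    then show "?join (?split gh) = gh"
      by (simp add: gh)
    have "(perm_restrict g ?B, perm_restrict h ?B) \<in> commuting_perms ?B"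
      using c assms(1) sub by (rule commuting_perms_restrict) (simp_all add: iff)
    moreover have "joint_orbit (perm_restrict g ?B) (perm_restrict h ?B) a = ?B"
      by (rule joint_orbit_cong[of _ ?B]) (simp_all add: joint_orbit_self iff perm_restrict_simps)
    ultimately have t: "(perm_restrict g ?B, perm_restrict h ?B) \<in> transitive_commuting_perms a ?B"
      by (simp add: transitive_commuting_perms_def)
    have c': "(perm_restrict g (A - ?B), perm_restrict h (A - ?B)) \<in> commuting_perms (A - ?B)"
      using c assms(1) by (rule commuting_perms_restrict)
        (auto simp: iff permutes_in_image[OF p(1)] permutes_in_image[OF p(2)])
    show "?split gh \<in> ?T"
      using sub t c' by (simp add: gh joint_orbit_self)
    show "?w (?split gh) = (case gh of (g, h) \<Rightarrow> orbit_weight y A g h)"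
      using orbit_weight_union(2)[OF joint_orbit_self sub assms(1) t c', of y]
      by (simp only: gh g h split_conv)
  next
    fix t
    assume "t \<in> ?T"
    then obtain B g1 h1 g2 h2 where t: "t = (B, (g1, h1), (g2, h2))" and B: "a \<in> B" "B \<subseteq> A"
      and t1: "(g1, h1) \<in> transitive_commuting_perms a B" and t2: "(g2, h2) \<in> commuting_perms (A - B)"
      by auto
    have c: "(g1, h1) \<in> commuting_perms B"
      using t1 by (simp add: transitive_commuting_perms_def)
    then show "?join t \<in> commuting_perms A"
      using commuting_perms_union[OF B(2) _ t2] by (simp add: t)
    have p: "g1 permutes B" "h1 permutes B" "g2 permutes A - B" "h2 permutes A - B"
      using c t2 by (auto simp: commuting_perms_def)
    have *: "perm_restrict (f1 \<circ> f2) B = f1 \<and> perm_restrict (f1 \<circ> f2) (A - B) = f2"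
      if f: "f1 permutes B" "f2 permutes A - B" for f1 f2
      using comp_disjoint_perms(1,2)[OF f] permutes_not_in[OF f(1)] permutes_not_in[OF f(2)]
      by (auto simp: fun_eq_iff perm_restrict_def simp del: comp_apply)
    show "?split (?join t) = t"
      using *[OF p(1,3)] *[OF p(2,4)] orbit_weight_union(1)[OF B assms(1) t1 t2] by (simp add: t)
  qed
  also have "\<dots> = (\<Sum>B | a \<in> B \<and> B \<subseteq> A.
      \<Sum>s \<in> transitive_commuting_perms a B. \<Sum>(g, h) \<in> commuting_perms (A - B).
        y (card B) * orbit_weight y (A - B) g h)"
  proof -
    have "finite {B. a \<in> B \<and> B \<subseteq> A}"
      by (rule finite_subset[of _ "Pow A"]) (use assms(1) in auto)
    moreover have "finite (transitive_commuting_perms a B)" "finite (commuting_perms (A - B))"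
      if "B \<subseteq> A" for B
      using finite_subset[OF that assms(1)] assms(1)
      by (simp_all add: finite_transitive_commuting_perms finite_commuting_perms)
    ultimately have "sum ?w ?T = (\<Sum>B | a \<in> B \<and> B \<subseteq> A.
        \<Sum>((g1, h1), (g2, h2)) \<in> transitive_commuting_perms a B \<times> commuting_perms (A - B).
          y (card B) * orbit_weight y (A - B) g2 h2)"
      by (intro sum.Sigma[symmetric]) auto
    then show ?thesis
      by (simp add: sum.cartesian_product split_def del: sum_constant)
  qed
  also have "\<dots> = (\<Sum>B | a \<in> B \<and> B \<subseteq> A.
    of_nat (card (transitive_commuting_perms a B)) * y (card B) * commuting_weight_sum y (A - B))"
    by (simp add: commuting_weight_sum_def sum_distrib_left split_def mult.assoc)
  finally show ?thesis .
qed

section \<open>Counting transitive commuting pairs\<close>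

text \<open>Coordinates on the orbit of \<open>a\<close>: the point reached by \<open>x\<close> steps of \<open>g\<close> and \<open>y\<close> steps of \<open>h\<close>.\<close>

definition grid_point :: "('a \<Rightarrow> 'a) \<Rightarrow> ('a \<Rightarrow> 'a) \<Rightarrow> 'a \<Rightarrow> nat \<times> nat \<Rightarrow> 'a"
  where "grid_point g h a = (\<lambda>(x, y). (h ^^ y) ((g ^^ x) a))"

text \<open>The pairs that wind an \<open>i\<close> by \<open>j\<close> grid around \<open>B\<close>: the rows are cycles of \<open>g\<close> of length \<open>i\<close>, and \<open>h\<close>
  climbs from row to row and comes back to the row of \<open>a\<close> after \<open>j\<close> steps, shifted by \<open>s\<close>.\<close>

definition winding_pairs ::
    "'a \<Rightarrow> 'a set \<Rightarrow> nat \<Rightarrow> nat \<Rightarrow> nat \<Rightarrow> (('a \<Rightarrow> 'a) \<times> ('a \<Rightarrow> 'a)) set"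
  where "winding_pairs a B i j s = {(g, h) \<in> commuting_perms B.
    bij_betw (grid_point g h a) ({..<i} \<times> {..<j}) B \<and> (g ^^ i) a = a \<and> (h ^^ j) a = (g ^^ s) a}"

text \<open>The action of \<open>g\<close> and of \<open>h\<close> in grid coordinates.\<close>

definition grid_turn :: "nat \<Rightarrow> nat \<times> nat \<Rightarrow> nat \<times> nat"
  where "grid_turn i = (\<lambda>(x, y). (Suc x mod i, y))"

definition grid_climb :: "nat \<Rightarrow> nat \<Rightarrow> nat \<Rightarrow> nat \<times> nat \<Rightarrow> nat \<times> nat"
  where "grid_climb i j s = (\<lambda>(x, y). if Suc y < j then (x, Suc y) else ((x + s) mod i, 0))"

text \<open>The map \<open>f\<close> carried along the labelling \<open>\<phi>\<close>, and the identity off the labelled set, as required of a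
  permutation of that set.\<close>

definition transport :: "'c set \<Rightarrow> ('c \<Rightarrow> 'a) \<Rightarrow> ('c \<Rightarrow> 'c) \<Rightarrow> 'a \<Rightarrow> 'a"
  where "transport C \<phi> f z = (if z \<in> \<phi> ` C then \<phi> (f (inv_into C \<phi> z)) else z)"

lemma transport_apply: "inj_on \<phi> C \<Longrightarrow> c \<in> C \<Longrightarrow> transport C \<phi> f (\<phi> c) = \<phi> (f c)"
  by (simp add: transport_def)

lemma transport_permutes:
  assumes \<phi>: "bij_betw \<phi> C B" and f: "bij_betw f C C"
  shows "transport C \<phi> f permutes B"
proof (rule bij_imp_permutes)
  have "bij_betw (\<phi> \<circ> (f \<circ> inv_into C \<phi>)) B B"
    using bij_betw_inv_into[OF \<phi>] f \<phi> by (intro bij_betw_trans)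
  moreover have "\<phi> ` C = B"
    using \<phi> by (simp add: bij_betw_def)
  ultimately show "bij_betw (transport C \<phi> f) B B"
    by (subst bij_betw_cong[where g = "\<phi> \<circ> (f \<circ> inv_into C \<phi>)"]) (simp_all add: transport_def)
  show "transport C \<phi> f z = z" if "z \<notin> B" for z
    using that \<open>\<phi> ` C = B\<close> by (simp add: transport_def)
qed

lemma add_mod_inj:
  fixes x x' s i :: nat
  assumes "x < i" "x' < i" "s \<le> i" "(x + s) mod i = (x' + s) mod i"
  shows "x = x'"
proof -
  have "(z + s) mod i = (if z + s < i then z + s else z + s - i)" if "z < i" for z
    using that assms(3) by (auto simp: le_mod_geq)
  then show ?thesis
    using assms by (auto split: if_splits)
qed

lemma bij_betw_grid_turn:
  assumes "0 < i"
  shows "bij_betw (grid_turn i) ({..<i} \<times> {..<j}) ({..<i} \<times> {..<j})"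
proof -
  let ?C = "{..<i} \<times> {..<j}"
  have "inj_on (grid_turn i) ?C"
    using assms by (auto simp: inj_on_def grid_turn_def intro: add_mod_inj[of _ i _ 1])
  moreover have "grid_turn i ` ?C \<subseteq> ?C"
    using assms by (auto simp: grid_turn_def)
  ultimately show ?thesis
    using endo_inj_surj[of ?C "grid_turn i"] by (simp add: bij_betw_def)
qed

lemma bij_betw_grid_climb:
  assumes "s < i" "0 < j"
  shows "bij_betw (grid_climb i j s) ({..<i} \<times> {..<j}) ({..<i} \<times> {..<j})"
proof -
  let ?C = "{..<i} \<times> {..<j}"
  have "inj_on (grid_climb i j s) ?C"
    using assms by (auto simp: inj_on_def grid_climb_def intro: add_mod_inj[of _ i _ s] split: if_splits)
  moreover have "grid_climb i j s ` ?C \<subseteq> ?C"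
    using assms by (auto simp: grid_climb_def split: if_splits)
  ultimately show ?thesis
    using endo_inj_surj[of ?C "grid_climb i j s"] by (simp add: bij_betw_def)
qed

lemma grid_turn_climb: "grid_turn i (grid_climb i j s c) = grid_climb i j s (grid_turn i c)"
  by (cases c) (simp add: grid_turn_def grid_climb_def mod_simps)

lemma grid_point_step:
  assumes comm: "g \<circ> h = h \<circ> g" and i: "(g ^^ i) a = a" and j: "(h ^^ j) a = (g ^^ s) a"
    and c: "c \<in> {..<i} \<times> {..<j}"
  shows "g (grid_point g h a c) = grid_point g h a (grid_turn i c)"
    and "h (grid_point g h a c) = grid_point g h a (grid_climb i j s c)"
proof -
  obtain x y where xy: "c = (x, y)" "x < i" "y < j"
    using c by auto
  have "g ((h ^^ y) ((g ^^ x) a)) = (h ^^ y) ((g ^^ Suc x) a)"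
    using funpow_swap[OF comm, of 1] by simp
  also have "(g ^^ Suc x) a = (g ^^ (Suc x mod i)) a"
    using funpow_mod_eq[where m = "Suc x", OF i] by simp
  finally show "g (grid_point g h a c) = grid_point g h a (grid_turn i c)"
    by (simp add: xy grid_point_def grid_turn_def)
  have "h ((h ^^ y) ((g ^^ x) a)) = (g ^^ ((x + s) mod i)) a" if "j = Suc y"
  proof -
    have "h ((h ^^ y) ((g ^^ x) a)) = (h ^^ j) ((g ^^ x) a)"
      by (simp add: that)
    also have "\<dots> = (g ^^ x) ((g ^^ s) a)"
      using funpow_swap[OF comm, of x j a] j by simp
    also have "\<dots> = (g ^^ ((x + s) mod i)) a"
      by (simp add: funpow_mod_eq[OF i] funpow_add)
    finally show ?thesis .
  qed
  moreover have "j = Suc y" if "\<not> Suc y < j"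
    using that xy by simp
  ultimately show "h (grid_point g h a c) = grid_point g h a (grid_climb i j s c)"
    by (auto simp: xy grid_point_def grid_climb_def)
qed

lemma funpow_cancel:
  assumes "inj g" "m \<le> n" "(g ^^ m) u = (g ^^ n) v"
  shows "u = (g ^^ (n - m)) v"
proof -
  have "(g ^^ m) u = (g ^^ m) ((g ^^ (n - m)) v)"
    using assms(2,3) by (metis comp_apply funpow_add le_add_diff_inverse)
  then show ?thesis
    using inj_fn[OF assms(1)] by (metis injD)
qed

text \<open>Take the least \<open>i > 0\<close> with \<open>(g ^^ i) a = a\<close> and the least \<open>j > 0\<close> for which \<open>(h ^^ j) a\<close> lies on the
  cycle of \<open>a\<close> under \<open>g\<close>. The grid points are then closed under \<open>g\<close> and \<open>h\<close>, hence exhaust \<open>B\<close>, and the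
  minimality of \<open>j\<close> and of \<open>i\<close> makes the rows and the points within a row distinct.\<close>

lemma transitive_pair_winds:
  assumes "finite B" "a \<in> B" "(g, h) \<in> transitive_commuting_perms a B"
  obtains i j s where "0 < i" "0 < j" "s < i" "(g, h) \<in> winding_pairs a B i j s"
proof -
  have gh: "(g, h) \<in> commuting_perms B" and orb: "joint_orbit g h a = B"
    using assms(3) by (auto simp: transitive_commuting_perms_def)
  then have g: "g permutes B" and h: "h permutes B" and comm: "g \<circ> h = h \<circ> g"
    by (auto simp: commuting_perms_def)
  have perm: "permutation g" "permutation h"
    using g h assms(1) by (auto simp: permutation_permutes)
  have inj: "inj g" "inj h"
    using g h permutes_inj by auto
  obtain N M where nilp: "g ^^ N = id" "0 < N" "h ^^ M = id" "0 < M"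
    using permutation_is_nilpotent[OF perm(1)] permutation_is_nilpotent[OF perm(2)] by metis
  have "\<exists>i. 0 < i \<and> (g ^^ i) a = a"
    by (rule exI[of _ N]) (simp add: nilp)
  then obtain i where i: "0 < i" "(g ^^ i) a = a" and imin: "\<And>m. m < i \<Longrightarrow> 0 < m \<Longrightarrow> (g ^^ m) a \<noteq> a"
    using exists_least_iff[of "\<lambda>i. 0 < i \<and> (g ^^ i) a = a"] by metis
  have "\<exists>j. 0 < j \<and> (\<exists>x. (h ^^ j) a = (g ^^ x) a)"
    by (rule exI[of _ M]) (simp add: nilp exI[of _ 0])
  then obtain j where j: "0 < j" "\<exists>x. (h ^^ j) a = (g ^^ x) a"
    and jmin: "\<And>m x. m < j \<Longrightarrow> 0 < m \<Longrightarrow> (h ^^ m) a \<noteq> (g ^^ x) a"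
    using exists_least_iff[of "\<lambda>j. 0 < j \<and> (\<exists>x. (h ^^ j) a = (g ^^ x) a)"] by metis
  then obtain x0 where "(h ^^ j) a = (g ^^ x0) a"
    by blast
  then have s: "(h ^^ j) a = (g ^^ (x0 mod i)) a"
    by (simp add: funpow_mod_eq[OF i(2)])
  let ?C = "{..<i} \<times> {..<j}" and ?gp = "grid_point g h a"
  have closed: "g z \<in> ?gp ` ?C" "h z \<in> ?gp ` ?C" if z: "z \<in> ?gp ` ?C" for z
  proof -
    obtain c where c: "c \<in> ?C" "z = ?gp c"
      using z by blast
    have "grid_turn i c \<in> ?C" "grid_climb i j (x0 mod i) c \<in> ?C"
      using c(1) i(1) j(1) by (auto simp: grid_turn_def grid_climb_def)
    then show "g z \<in> ?gp ` ?C" "h z \<in> ?gp ` ?C"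
      using grid_point_step[OF comm i(2) s c(1)] c(2) by auto
  qed
  have "?gp (0, 0) = a"
    by (simp add: grid_point_def)
  then have "a \<in> ?gp ` ?C"
    using i(1) j(1) by (metis SigmaI imageI lessThan_iff)
  then have "B \<subseteq> ?gp ` ?C"
    using closed orb joint_orbit_least[of a "?gp ` ?C" g h] by blast
  moreover have "?gp c \<in> B" for c
    using orb by (auto simp: grid_point_def joint_orbit_def split: prod.split)
  ultimately have img: "?gp ` ?C = B"
    by blast
  have eq: "x = x' \<and> y = y'"
    if "x < i" "x' < i" "y \<le> y'" "y' < j" "(h ^^ y) ((g ^^ x) a) = (h ^^ y') ((g ^^ x') a)" for x y x' y'
  proof -
    let ?d = "y' - y"
    have 1: "(g ^^ x) a = (h ^^ ?d) ((g ^^ x') a)"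
      using funpow_cancel[OF inj(2) that(3,5)] .
    \<comment> \<open>completing the cycle of \<open>g\<close> from \<open>x'\<close> on shows that \<open>(h ^^ ?d) a\<close> lies on the cycle of \<open>a\<close>\<close>
    have "(g ^^ (i - x' + x)) a = (g ^^ (i - x')) ((h ^^ ?d) ((g ^^ x') a))"
      by (simp add: funpow_add 1)
    also have "\<dots> = (h ^^ ?d) ((g ^^ (i - x' + x')) a)"
      by (simp add: funpow_swap[OF comm] funpow_add)
    also have "(g ^^ (i - x' + x')) a = a"
      using that(2) i(2) by simp
    finally have "?d = 0"
      using jmin[of ?d "i - x' + x"] that(4) by fastforce
    then have "(g ^^ x) a = (g ^^ x') a"
      using 1 by simp
    moreover have "x - x' < i" "x' - x < i"
      using that(1,2) by simp_all
    ultimately have "\<not> x < x'" "\<not> x' < x"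
      using funpow_cancel[OF inj(1), of x x' a a] imin[of "x' - x"]
        funpow_cancel[OF inj(1), of x' x a a] imin[of "x - x'"] by auto
    then show ?thesis
      using \<open>?d = 0\<close> that(3) by simp
  qed
  have "inj_on ?gp ?C"
  proof (rule inj_onI)
    fix c c'
    assume c: "c \<in> ?C" "c' \<in> ?C" "?gp c = ?gp c'"
    obtain x y x' y' where xy: "c = (x, y)" "c' = (x', y')"
      using prod.exhaust by metis
    have lt: "x < i" "x' < i" "y < j" "y' < j"
      using c(1,2) by (simp_all add: xy)
    have eq': "(h ^^ y) ((g ^^ x) a) = (h ^^ y') ((g ^^ x') a)"
      using c(3) by (simp add: xy grid_point_def)
    show "c = c'"
    proof (cases "y \<le> y'")
      case True
      show ?thesis
        using eq[OF lt(1,2) True lt(4) eq'] by (simp add: xy)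
    next
      case False
      then show ?thesis
        using eq[OF lt(2,1) _ lt(3) eq'[symmetric]] by (simp add: xy)
    qed
  qed
  then have "(g, h) \<in> winding_pairs a B i j (x0 mod i)"
    using gh img i(2) s by (simp add: winding_pairs_def bij_betw_def)
  then show thesis
    using i(1) j(1) by (intro that[of i j "x0 mod i"]) simp_all
qed

lemma winding_pairs_transitive:
  assumes "a \<in> B"
  shows "winding_pairs a B i j s \<subseteq> transitive_commuting_perms a B"
proof
  fix gh
  assume "gh \<in> winding_pairs a B i j s"
  then obtain g h where gh: "gh = (g, h)" "(g, h) \<in> commuting_perms B"
    "grid_point g h a ` ({..<i} \<times> {..<j}) = B"
    by (auto simp: winding_pairs_def bij_betw_def)
  have "grid_point g h a c \<in> joint_orbit g h a" for c
    by (auto simp: grid_point_def joint_orbit_def split: prod.split)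
  then show "gh \<in> transitive_commuting_perms a B"
    using gh joint_orbit_subset[OF gh(2) assms] by (auto simp: transitive_commuting_perms_def)
qed

lemma winding_pairs_card: 
  assumes "gh \<in> winding_pairs a B i j s"
  shows "i * j = card B"
  using assms bij_betw_same_card by (fastforce simp: winding_pairs_def)

text \<open>The grid is recovered from the pair: \<open>i\<close> is the length of the cycle of \<open>a\<close> under \<open>g\<close>, then \<open>j\<close> follows
  from the size of \<open>B\<close>, and \<open>s\<close> is the position of \<open>(h ^^ j) a\<close> on that cycle.\<close>

lemma winding_unique:
  assumes 1: "gh \<in> winding_pairs a B i j s" "s < i" "0 < j"
    and 2: "gh \<in> winding_pairs a B i' j' s'" "s' < i'" "0 < j'"
  shows "i = i' \<and> s = s'"
proof -
  obtain g h where gh: "gh = (g, h)"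
    by (cases gh)
  have inj: "inj_on (grid_point g h a) ({..<i} \<times> {..<j})" "inj_on (grid_point g h a) ({..<i'} \<times> {..<j'})"
    and per: "(g ^^ i) a = a" "(g ^^ i') a = a" and s: "(h ^^ j) a = (g ^^ s) a" "(h ^^ j') a = (g ^^ s') a"
    using 1 2 by (auto simp: gh winding_pairs_def bij_betw_def)
  have gp: "grid_point g h a (x, 0) = (g ^^ x) a" for x
    by (simp add: grid_point_def)
  have "\<not> i < i'"
    using inj_onD[OF inj(2), of "(i, 0)" "(0, 0)"] 1 2 per by (auto simp: gp)
  moreover have "\<not> i' < i"
    using inj_onD[OF inj(1), of "(i', 0)" "(0, 0)"] 1 2 per by (auto simp: gp)
  ultimately have i: "i = i'"
    by simp
  moreover have "j = j'"
    using winding_pairs_card[OF 1(1)] winding_pairs_card[OF 2(1)] i 1(2) by (metis mult_cancel1 not_less0)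
  moreover have "s = s'"
    using inj_onD[OF inj(1), of "(s, 0)" "(s', 0)"] 1 2 i \<open>j = j'\<close> s by (auto simp: gp)
  ultimately show ?thesis
    by simp
qed

text \<open>Conversely, every labelling of \<open>B\<close> by the grid with \<open>a\<close> at the origin is the coordinate system of a
  winding pair, namely of the grid moves carried over to \<open>B\<close>.\<close>

lemma transport_winding_pair:
  fixes \<phi> :: "nat \<times> nat \<Rightarrow> 'a"
  defines "C \<equiv> \<lambda>i j. {..<i} \<times> {..<j}"
  assumes \<phi>: "bij_betw \<phi> (C i j) B" "\<phi> (0, 0) = a" and pos: "0 < j" "s < i"
  defines "g \<equiv> transport (C i j) \<phi> (grid_turn i)" and "h \<equiv> transport (C i j) \<phi> (grid_climb i j s)"
  shows "c \<in> C i j \<Longrightarrow> grid_point g h a c = \<phi> c" and "(g, h) \<in> winding_pairs a B i j s"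
proof -
  have i: "0 < i"
    using pos by simp
  have inj: "inj_on \<phi> (C i j)" and img: "\<phi> ` C i j = B"
    using \<phi> by (auto simp: bij_betw_def)
  have bij: "bij_betw (grid_turn i) (C i j) (C i j)" "bij_betw (grid_climb i j s) (C i j) (C i j)"
    unfolding C_def using bij_betw_grid_turn bij_betw_grid_climb i pos by auto
  have g: "g (\<phi> c) = \<phi> (grid_turn i c)" and h: "h (\<phi> c) = \<phi> (grid_climb i j s c)" if "c \<in> C i j" for c
    using that inj by (simp_all add: g_def h_def transport_apply)
  have perm: "g permutes B" "h permutes B"
    unfolding g_def h_def using \<phi>(1) bij by (auto intro: transport_permutes)
  have "g (h z) = h (g z)" for z
  proof (cases "z \<in> B")
    case True
    then obtain c where c: "c \<in> C i j" "z = \<phi> c"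
      using img by blast
    have "grid_turn i c \<in> C i j" "grid_climb i j s c \<in> C i j"
      using bij c(1) by (auto simp: bij_betw_def)
    then show ?thesis
      using c g h by (simp add: grid_turn_climb)
  next
    case False
    then show ?thesis
      using perm by (simp add: permutes_not_in)
  qed
  then have gh: "(g, h) \<in> commuting_perms B"
    using perm by (auto simp: commuting_perms_def)
  have x: "(g ^^ x) a = \<phi> (x, 0)" if "x < i" for x
    using that
  proof (induction x)
    case (Suc x)
    then show ?case
      using g[of "(x, 0)"] pos by (simp add: C_def grid_turn_def)
  qed (simp add: \<phi>)
  have xy: "(h ^^ y) ((g ^^ x) a) = \<phi> (x, y)" if "x < i" "y < j" for x y
    using that(2)
  proof (induction y)
    case (Suc y)
    then show ?case
      using h[of "(x, y)"] that by (simp add: C_def grid_climb_def)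
  qed (simp add: x that)
  show gp: "grid_point g h a c = \<phi> c" if "c \<in> C i j" for c
    using that xy by (auto simp: grid_point_def C_def)
  have "bij_betw (grid_point g h a) (C i j) B"
    using \<phi>(1) gp by (metis bij_betw_cong)
  moreover obtain m where m: "i = Suc m"
    using i by (metis Suc_pred)
  have "(g ^^ i) a = a"
    using x[of m] g[of "(m, 0)"] pos \<phi>(2) by (simp add: m C_def grid_turn_def)
  moreover obtain l where l: "j = Suc l"
    using pos(1) by (metis Suc_pred)
  have "(h ^^ j) a = (g ^^ s) a"
    using xy[of 0 l] h[of "(0, l)"] pos i x[of s] by (simp add: l C_def grid_climb_def)
  ultimately show "(g, h) \<in> winding_pairs a B i j s"
    using gh by (simp add: winding_pairs_def C_def)
qed

text \<open>For fixed \<open>i\<close>, \<open>j\<close> and \<open>s\<close>, winding pairs correspond to labellings of \<open>B\<close> by the grid with \<open>a\<close> at the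
  origin. Relative to one such labelling \<open>e\<close>, these are the maps \<open>p \<circ> e\<close> for the permutations \<open>p\<close> of
  the remaining points.\<close>

lemma card_winding_pairs:
  assumes "finite B" "a \<in> B" "0 < j" "s < i" "i * j = card B"
  shows "card (winding_pairs a B i j s) = fact (card B - 1)"
proof -
  let ?C = "{..<i} \<times> {..<j}"
  have origin: "(0, 0) \<in> ?C"
    using assms by auto
  obtain e0 where e0: "bij_betw e0 ?C B"
    using finite_same_card_bij[of ?C B] assms by auto
  \<comment> \<open>swapping two labels puts \<open>a\<close> at the origin\<close>
  have "bij_betw (transpose (e0 (0, 0)) a) B B"
    using e0 origin assms(2) by (intro permutes_imp_bij permutes_swap_id) (auto simp: bij_betw_def)
  then obtain e where e: "bij_betw e ?C B" "e (0, 0) = a"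
    using bij_betw_trans[OF e0] by (metis comp_apply transpose_apply_first)
  let ?P = "{p. p permutes B - {a}}"
  let ?F = "\<lambda>p. (transport ?C (p \<circ> e) (grid_turn i), transport ?C (p \<circ> e) (grid_climb i j s))"
  have p\<phi>: "bij_betw (p \<circ> e) ?C B" "(p \<circ> e) (0, 0) = a" if "p \<in> ?P" for p
  proof -
    have "p permutes B"
      using that by (auto intro: permutes_subset)
    then show "bij_betw (p \<circ> e) ?C B"
      using e(1) permutes_imp_bij bij_betw_trans by blast
    show "(p \<circ> e) (0, 0) = a"
      using that e(2) permutes_not_in[of p "B - {a}" a] by simp
  qed
  have "bij_betw ?F ?P (winding_pairs a B i j s)"
    unfolding bij_betw_def
  proof
    show "inj_on ?F ?P"
    proof (rule inj_onI)
      fix p q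
      assume p: "p \<in> ?P" and q: "q \<in> ?P" and eq: "?F p = ?F q"
      have "(p \<circ> e) c = (q \<circ> e) c" if "c \<in> ?C" for c
        using transport_winding_pair(1)[OF p\<phi>[OF p] assms(3,4) that]
          transport_winding_pair(1)[OF p\<phi>[OF q] assms(3,4) that] eq
        by (simp del: comp_apply)
      then have "p z = q z" if "z \<in> B" for z
        using that e(1) by (auto simp: bij_betw_def)
      moreover have "p z = q z" if "z \<notin> B" for z
        using p q that by (simp add: permutes_not_in)
      ultimately show "p = q"
        by blast
    qed
    show "?F ` ?P = winding_pairs a B i j s"
    proof
      show "?F ` ?P \<subseteq> winding_pairs a B i j s"
        using transport_winding_pair(2)[OF p\<phi> assms(3,4)] by blast
      show "winding_pairs a B i j s \<subseteq> ?F ` ?P"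
      proof
        fix gh
        assume "gh \<in> winding_pairs a B i j s"
        then obtain g h where gh: "gh = (g, h)" "(g, h) \<in> commuting_perms B"
          and bij: "bij_betw (grid_point g h a) ?C B"
          and per: "(g ^^ i) a = a" "(h ^^ j) a = (g ^^ s) a"
          by (auto simp: winding_pairs_def)
        have perm: "g permutes B" "h permutes B" and comm: "g \<circ> h = h \<circ> g"
          using gh(2) by (auto simp: commuting_perms_def)
        let ?e' = "inv_into ?C e"
        define p where "p z = (if z \<in> B then grid_point g h a (?e' z) else z)" for z
        have e': "?e' (e c) = c" if "c \<in> ?C" for c
          using e(1) that by (auto simp: bij_betw_def)
        have pe: "(p \<circ> e) c = grid_point g h a c" if "c \<in> ?C" for c
          using that e(1) e'[OF that] by (auto simp: p_def bij_betw_def)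
        have "bij_betw (grid_point g h a \<circ> ?e') B B"
          using bij_betw_inv_into[OF e(1)] bij by (rule bij_betw_trans)
        then have "bij_betw p B B"
          by (rule bij_betw_cong[THEN iffD1, rotated]) (simp add: p_def)
        then have "p permutes B"
          by (rule bij_imp_permutes) (simp add: p_def)
        moreover have "p a = a"
          using pe[OF origin] e(2) by (simp add: grid_point_def)
        ultimately have p: "p \<in> ?P"
          by (auto intro: permutes_superset)
        have img: "(p \<circ> e) ` ?C = B" and inj: "inj_on (p \<circ> e) ?C"
          using p\<phi>(1)[OF p] by (auto simp: bij_betw_def)
        have "f z = transport ?C (p \<circ> e) f0 z"
          if f: "f permutes B" "bij_betw f0 ?C ?C"
            "\<And>c. c \<in> ?C \<Longrightarrow> f (grid_point g h a c) = grid_point g h a (f0 c)" for f f0 z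
        proof (cases "z \<in> B")
          case True
          then obtain c where c: "c \<in> ?C" "z = (p \<circ> e) c"
            using img by blast
          have "f0 c \<in> ?C"
            using f(2) c(1) by (auto simp: bij_betw_def)
          then show ?thesis
            using transport_apply[OF inj c(1), of f0] f(3)[OF c(1)] c pe by metis
        next
          case False
          then show ?thesis
            using f(1) img by (simp add: transport_def permutes_not_in del: comp_apply)
        qed
        then have "g = transport ?C (p \<circ> e) (grid_turn i)" "h = transport ?C (p \<circ> e) (grid_climb i j s)"
          using perm grid_point_step[OF comm per] bij_betw_grid_turn[of i j] bij_betw_grid_climb[OF assms(4,3)]
            assms(4) by (auto intro!: ext)
        then show "gh \<in> ?F ` ?P"
          using p gh(1) by blast
      qed
    qed
  qed
  then have "card (winding_pairs a B i j s) = card ?P"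
    by (simp add: bij_betw_same_card)
  also have "\<dots> = fact (card B - 1)"
    using assms(1,2) by (intro card_permutations) simp_all
  finally show ?thesis .
qed

text \<open>A transitive pair has a width \<open>i\<close>, which divides \<open>card B\<close>, and one of \<open>i\<close> possible shifts; hence the
  divisor sum.\<close>

lemma card_transitive_commuting_perms:
  assumes "finite B" "a \<in> B"
  shows "card (transitive_commuting_perms a B) = (\<Sum>i | i dvd card B. i) * fact (card B - 1)"
proof -
  let ?k = "card B"
  have k: "0 < ?k"
    using assms by (auto simp: card_gt_0_iff)
  let ?I = "SIGMA i:{i. i dvd ?k}. {..<i}"
  have fin: "finite {i. i dvd ?k}"
    using k by (simp add: finite_divisors_nat)
  have pos: "0 < ?k div i" "i * (?k div i) = ?k" if "i dvd ?k" for i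
    using that k by (auto simp: div_greater_zero_iff intro: dvd_imp_le elim: dvd_pos_nat)
  have "transitive_commuting_perms a B = (\<Union>(i, s) \<in> ?I. winding_pairs a B i (?k div i) s)"
  proof
    show "transitive_commuting_perms a B \<subseteq> (\<Union>(i, s) \<in> ?I. winding_pairs a B i (?k div i) s)"
    proof
      fix gh
      assume "gh \<in> transitive_commuting_perms a B"
      then obtain i j s where ijs: "0 < i" "0 < j" "s < i" "gh \<in> winding_pairs a B i j s"
        using transitive_pair_winds[OF assms] by (metis surj_pair)
      then have "?k = i * j"
        using winding_pairs_card by metis
      then have "i dvd ?k" "?k div i = j"
        using ijs by auto
      then show "gh \<in> (\<Union>(i, s) \<in> ?I. winding_pairs a B i (?k div i) s)"
        using ijs by auto
    qed
    show "(\<Union>(i, s) \<in> ?I. winding_pairs a B i (?k div i) s) \<subseteq> transitive_commuting_perms a B"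
      using winding_pairs_transitive[OF assms(2)] by blast
  qed
  moreover have disj: "winding_pairs a B i (?k div i) s \<inter> winding_pairs a B i' (?k div i') s' = {}"
    if "i dvd ?k" "s < i" "i' dvd ?k" "s' < i'" "i = i' \<longrightarrow> s \<noteq> s'" for i s i' s'
    using winding_unique[OF _ that(2) pos(1)[OF that(1)] _ that(4) pos(1)[OF that(3)]]
      that(5) by (metis disjoint_iff)
  ultimately have "card (transitive_commuting_perms a B) = card (\<Union>(i, s) \<in> ?I. winding_pairs a B i (?k div i) s)"
    by simp
  also have "\<dots> = (\<Sum>(i, s) \<in> ?I. card (winding_pairs a B i (?k div i) s))"
  proof (subst card_UN_disjoint)
    show "finite ?I"
      using fin by auto
    have "finite (winding_pairs a B i j s)" for i j s
      using winding_pairs_transitive[OF assms(2)] finite_transitive_commuting_perms[OF assms(1)]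
      by (rule finite_subset)
    then show "\<forall>p\<in>?I. finite (case p of (i, s) \<Rightarrow> winding_pairs a B i (?k div i) s)"
      by auto
    show "\<forall>p\<in>?I. \<forall>q\<in>?I. p \<noteq> q \<longrightarrow> (case p of (i, s) \<Rightarrow> winding_pairs a B i (?k div i) s) \<inter>
        (case q of (i, s) \<Rightarrow> winding_pairs a B i (?k div i) s) = {}"
      using disj by auto
  qed (simp add: split_def)
  also have "\<dots> = (\<Sum>(i, s) \<in> ?I. fact (?k - 1))"
    using card_winding_pairs[OF assms] pos by (intro sum.cong) auto
  also have "\<dots> = (\<Sum>i | i dvd ?k. i) * fact (?k - 1)"
    using fin by (simp add: sum.Sigma[symmetric] sum_distrib_right)
  finally show ?thesis .
qed

section \<open>The weighted number of commuting pairs\<close>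

lemma commuting_weight_sum_empty: "commuting_weight_sum y ({} :: 'a set) = 1"
proof -
  have "commuting_perms ({} :: 'a set) = {(id, id)}"
    by (auto simp: commuting_perms_def permutes_empty)
  then show ?thesis
    by (simp add: commuting_weight_sum_def orbit_weight_def)
qed

lemma sum_over_subsets_containing:
  fixes f :: "nat \<Rightarrow> 'r::comm_semiring_1"
  assumes "finite A" "a \<in> A" "card A = Suc N"
  shows "(\<Sum>B | a \<in> B \<and> B \<subseteq> A. f (card B)) = (\<Sum>m\<le>N. of_nat (N choose m) * f (Suc m))"
proof -
  have fin: "finite (A - {a})" and N: "card (A - {a}) = N"
    using assms by simp_all
  have "(\<Sum>B | a \<in> B \<and> B \<subseteq> A. f (card B)) = (\<Sum>C \<in> Pow (A - {a}). f (Suc (card C)))"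
  proof (rule sum.reindex_bij_witness[of _ "insert a" "\<lambda>B. B - {a}"])
    fix B
    assume B: "B \<in> {B. a \<in> B \<and> B \<subseteq> A}"
    then have "finite B"
      using assms(1) finite_subset by auto
    then show "f (Suc (card (B - {a}))) = f (card B)"
      using B card_Suc_Diff1[of B a] by simp
  qed (use assms(2) in auto)
  also have "\<dots> = (\<Sum>m\<le>N. \<Sum>C \<in> {C \<in> Pow (A - {a}). card C = m}. f (Suc (card C)))"
    using fin N card_mono[OF fin] by (intro sum.group[symmetric]) auto
  also have "\<dots> = (\<Sum>m\<le>N. of_nat (N choose m) * f (Suc m))"
  proof (rule sum.cong[OF refl])
    fix m
    have "(\<Sum>C \<in> {C \<in> Pow (A - {a}). card C = m}. f (Suc (card C)))
        = (\<Sum>C | C \<subseteq> A - {a} \<and> card C = m. f (Suc m))"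
      by (rule sum.cong) auto
    also have "\<dots> = of_nat (N choose m) * f (Suc m)"
      using n_subsets[OF fin, of m] N by simp
    finally show "(\<Sum>C \<in> {C \<in> Pow (A - {a}). card C = m}. f (Suc (card C)))
        = of_nat (N choose m) * f (Suc m)" .
  qed
  finally show ?thesis .
qed

text \<open>Here \<open>R n\<close> plays the role of the weight sum divided by \<open>n!\<close>, in a form that makes sense without
  division. There are \<open>N choose m\<close> candidates of size \<open>m + 1\<close> for the orbit of a point, each carries
  \<open>m!\<close> times a divisor sum of transitive pairs, and the other points contribute \<open>(N - m)!\<close>; together
  these factors give \<open>N!\<close> for every \<open>m\<close>, and the hypothesis on \<open>R\<close> remains.\<close>

lemma commuting_weight_sum_eq:
  fixes y R :: "nat \<Rightarrow> 'r::comm_semiring_1"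
  assumes R0: "R 0 = 1"
    and RSuc: "\<And>N. of_nat (Suc N) * R (Suc N)
      = (\<Sum>m\<le>N. of_nat (\<Sum>i | i dvd Suc m. i) * y (Suc m) * R (N - m))"
    and "finite A"
  shows "commuting_weight_sum y A = of_nat (fact (card A)) * R (card A)"
  using assms(3)
proof (induction "card A" arbitrary: A rule: less_induct)
  case less
  show ?case
  proof (cases "card A")
    case 0
    then show ?thesis
      using less.prems by (simp add: commuting_weight_sum_empty R0)
  next
    case (Suc N)
    then obtain a where a: "a \<in> A"
      by fastforce
    let ?\<sigma> = "\<lambda>k::nat. \<Sum>i | i dvd k. i"
    let ?f = "\<lambda>k. of_nat (?\<sigma> k * fact (k - 1)) * y k * (of_nat (fact (Suc N - k)) * R (Suc N - k))"
    have "commuting_weight_sum y A = (\<Sum>B | a \<in> B \<and> B \<subseteq> A. ?f (card B))"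
      unfolding commuting_weight_sum_rec[OF less.prems a]
    proof (rule sum.cong[OF refl])
      fix B
      assume "B \<in> {B. a \<in> B \<and> B \<subseteq> A}"
      then have B: "a \<in> B" "B \<subseteq> A" "finite B"
        using less.prems finite_subset by auto
      have "card (A - B) = Suc N - card B"
        using B card_Diff_subset Suc by metis
      moreover have "card (A - B) < card A"
        using B less.prems by (intro psubset_card_mono) auto
      ultimately have "commuting_weight_sum y (A - B) = of_nat (fact (Suc N - card B)) * R (Suc N - card B)"
        using less.hyps[of "A - B"] less.prems by simp
      then show "of_nat (card (transitive_commuting_perms a B)) * y (card B) * commuting_weight_sum y (A - B)
          = ?f (card B)"
        using card_transitive_commuting_perms[OF B(3,1)] by simp
    qed
    also have "\<dots> = (\<Sum>m\<le>N. of_nat (N choose m) * ?f (Suc m))"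
      using less.prems a Suc by (rule sum_over_subsets_containing)
    also have "\<dots> = (\<Sum>m\<le>N. of_nat (fact N) * (of_nat (?\<sigma> (Suc m)) * y (Suc m) * R (N - m)))"
    proof (rule sum.cong[OF refl])
      fix m
      assume "m \<in> {..N}"
      then have "(fact N :: nat) = (N choose m) * fact m * fact (N - m)"
        using binomial_fact_lemma[of m N] by (simp add: ac_simps)
      then have "(of_nat (fact N) :: 'r) = of_nat (N choose m) * of_nat (fact m) * of_nat (fact (N - m))"
        by (metis of_nat_mult)
      then show "of_nat (N choose m) * ?f (Suc m)
          = of_nat (fact N) * (of_nat (?\<sigma> (Suc m)) * y (Suc m) * R (N - m))"
        by (simp add: ac_simps del: of_nat_fact of_nat_sum)
    qed
    also have "\<dots> = of_nat (fact N) * (of_nat (Suc N) * R (Suc N))"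
      unfolding RSuc by (simp only: sum_distrib_left)
    also have "\<dots> = of_nat (fact (Suc N)) * R (Suc N)"
      by (simp only: fact_Suc of_nat_mult of_nat_id mult.assoc mult.left_commute)
    finally show ?thesis
      by (simp only: Suc)
  qed
qed

section \<open>The sum over partitions of depth 2\<close>

lemma mpoly_const_1: "mpoly_const 1 = 1"
  by (simp add: mpoly_const_def)

lemma mpoly_const_mult: "mpoly_const (a * b) = mpoly_const a * mpoly_const b"
  by (simp add: mpoly_const_def mult_single)

lemma mpoly_const_of_nat: "mpoly_const (of_nat n) = of_nat n"
  by (simp add: mpoly_const_def)

lemma mpoly_const_prod: "mpoly_const (prod f S) = (\<Prod>x\<in>S. mpoly_const (f x))"
  by (induction S rule: infinite_finite_induct) (simp_all add: mpoly_const_1 mpoly_const_mult)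

text \<open>An entry \<open>\<beta> (i, j) = m\<close> stands for \<open>m\<close> orbits, each consisting of \<open>j\<close> cycles of length \<open>i\<close> of the first
  permutation.\<close>

definition entry_weight :: "(nat \<Rightarrow> rat_mpoly) \<Rightarrow> nat \<times> nat \<Rightarrow> nat \<Rightarrow> rat_mpoly"
  where "entry_weight y = (\<lambda>(i, j) m. mpoly_const (1 / (of_nat j ^ m * fact m)) * y (i * j) ^ m)"

definition depth2_weight :: "(nat \<Rightarrow> rat_mpoly) \<Rightarrow> (nat \<times> nat \<Rightarrow> nat) \<Rightarrow> rat_mpoly"
  where "depth2_weight y \<beta> = (\<Prod>p | \<beta> p \<noteq> 0. entry_weight y p (\<beta> p))"

lemma entry_weight_0: "entry_weight y p 0 = 1"
  by (simp add: entry_weight_def mpoly_const_1 split: prod.split)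

lemma entry_weight_Suc:
  assumes "0 < j"
  shows "of_nat (j * Suc m) * entry_weight y (i, j) (Suc m) = y (i * j) * entry_weight y (i, j) m"
proof -
  have "(of_nat (j * Suc m) :: rat) * (1 / (of_nat j ^ Suc m * fact (Suc m))) = 1 / (of_nat j ^ m * fact m)"
  proof -
    have cancel: "(c * b) * (1 / (c * u * (b * v))) = 1 / (u * v)" if "c \<noteq> 0" "b \<noteq> 0" for b c u v :: rat
      using that by simp
    have "(of_nat j :: rat) \<noteq> 0" "(of_nat (Suc m) :: rat) \<noteq> 0"
      using assms by (simp_all only: of_nat_eq_0_iff)
    from cancel[OF this] show ?thesis
      by (simp only: of_nat_mult power_Suc fact_Suc)
  qed
  then have "mpoly_const (of_nat (j * Suc m)) * mpoly_const (1 / (of_nat j ^ Suc m * fact (Suc m)))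
      = mpoly_const (1 / (of_nat j ^ m * fact m))"
    by (simp only: mpoly_const_mult[symmetric])
  then have "of_nat (j * Suc m) * mpoly_const (1 / (of_nat j ^ Suc m * fact (Suc m)))
      = mpoly_const (1 / (of_nat j ^ m * fact m))"
    by (simp only: mpoly_const_of_nat)
  then show ?thesis
    unfolding entry_weight_def by (simp only: split_conv power_Suc mult.assoc[symmetric]) (simp only: ac_simps)
qed

lemma depth2_weight_superset:
  assumes "finite S" "{p. \<beta> p \<noteq> 0} \<subseteq> S"
  shows "depth2_weight y \<beta> = (\<Prod>p\<in>S. entry_weight y p (\<beta> p))"
  unfolding depth2_weight_def using assms
  by (intro prod.mono_neutral_left) (auto simp: entry_weight_0)

text \<open>One more orbit of type \<open>(i, j)\<close> multiplies the weight by \<open>y (i * j) / (j * (\<beta> (i, j) + 1))\<close>. Multiplied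
  by the number of points on orbits of that type, this leaves the factor \<open>i * y (i * j)\<close>, which does
  not depend on \<open>\<beta>\<close>.\<close>

lemma depth2_weight_increment:
  assumes "finite {p. \<beta> p \<noteq> 0}" "0 < j"
  shows "of_nat (i * j * Suc (\<beta> (i, j))) * depth2_weight y (\<beta>((i, j) := Suc (\<beta> (i, j))))
    = of_nat i * y (i * j) * depth2_weight y \<beta>"
proof -
  let ?\<beta> = "\<beta>((i, j) := Suc (\<beta> (i, j)))"
  define S where "S = insert (i, j) {p. \<beta> p \<noteq> 0}"
  have S: "finite S" "(i, j) \<in> S"
    using assms(1) by (simp_all add: S_def)
  have "depth2_weight y ?\<beta> = (\<Prod>p\<in>S. entry_weight y p (?\<beta> p))"
    using S(1) by (rule depth2_weight_superset) (auto simp: S_def)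
  also have "\<dots> = entry_weight y (i, j) (Suc (\<beta> (i, j))) * (\<Prod>p\<in>S - {(i, j)}. entry_weight y p (?\<beta> p))"
    using S by (subst prod.remove[of _ "(i, j)"]) simp_all
  also have "(\<Prod>p\<in>S - {(i, j)}. entry_weight y p (?\<beta> p)) = (\<Prod>p\<in>S - {(i, j)}. entry_weight y p (\<beta> p))"
    by (rule prod.cong) auto
  finally have 1: "depth2_weight y ?\<beta>
    = entry_weight y (i, j) (Suc (\<beta> (i, j))) * (\<Prod>p\<in>S - {(i, j)}. entry_weight y p (\<beta> p))" .
  have "depth2_weight y \<beta> = (\<Prod>p\<in>S. entry_weight y p (\<beta> p))"
    using S(1) by (rule depth2_weight_superset) (auto simp: S_def)
  also have "\<dots> = entry_weight y (i, j) (\<beta> (i, j)) * (\<Prod>p\<in>S - {(i, j)}. entry_weight y p (\<beta> p))"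
    using S by (rule prod.remove)
  finally have 2: "depth2_weight y \<beta>
    = entry_weight y (i, j) (\<beta> (i, j)) * (\<Prod>p\<in>S - {(i, j)}. entry_weight y p (\<beta> p))" .
  have "of_nat (i * j * Suc (\<beta> (i, j))) * depth2_weight y ?\<beta>
      = of_nat i * (of_nat (j * Suc (\<beta> (i, j))) * entry_weight y (i, j) (Suc (\<beta> (i, j))))
        * (\<Prod>p\<in>S - {(i, j)}. entry_weight y p (\<beta> p))"
    unfolding 1 by (simp only: of_nat_mult mult.assoc)
  then show ?thesis
    unfolding entry_weight_Suc[OF assms(2)] 2 by (simp only: mult.assoc)
qed

lemma depth2_partition_increment_iff:
  assumes "0 < i" "0 < j"
  shows "depth2_partition (m + i * j) (\<beta>((i, j) := Suc (\<beta> (i, j)))) \<longleftrightarrow> depth2_partition m \<beta>"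
proof -
  let ?\<beta> = "\<beta>((i, j) := Suc (\<beta> (i, j)))"
  have supp: "{p. ?\<beta> p \<noteq> 0} = insert (i, j) {p. \<beta> p \<noteq> 0}"
    by auto
  have zero: "(\<forall>i' j'. i' = 0 \<or> j' = 0 \<longrightarrow> ?\<beta> (i', j') = 0)
      \<longleftrightarrow> (\<forall>i' j'. i' = 0 \<or> j' = 0 \<longrightarrow> \<beta> (i', j') = 0)"
    using assms by auto
  have size: "(\<Sum>(i, j) | \<gamma> (i, j) \<noteq> 0. i * j * \<gamma> (i, j))
      = (\<Sum>p \<in> insert (i, j) {p. \<beta> p \<noteq> 0}. fst p * snd p * \<gamma> p)"
    if "finite {p. \<beta> p \<noteq> 0}" "{p. \<gamma> p \<noteq> 0} \<subseteq> insert (i, j) {p. \<beta> p \<noteq> 0}"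
    for \<gamma> :: "nat \<times> nat \<Rightarrow> nat"
    using that by (intro sum.mono_neutral_cong_left) auto
  have "(\<Sum>(i, j) | ?\<beta> (i, j) \<noteq> 0. i * j * ?\<beta> (i, j))
      = i * j + (\<Sum>(i, j) | \<beta> (i, j) \<noteq> 0. i * j * \<beta> (i, j))"
    if fin: "finite {p. \<beta> p \<noteq> 0}"
  proof -
    let ?S = "insert (i, j) {p. \<beta> p \<noteq> 0}"
    have S: "finite ?S" "(i, j) \<in> ?S"
      using fin by simp_all
    have "(\<Sum>p \<in> ?S. fst p * snd p * ?\<beta> p)
        = i * j * Suc (\<beta> (i, j)) + (\<Sum>p \<in> ?S - {(i, j)}. fst p * snd p * ?\<beta> p)"
      using sum.remove[OF S, of "\<lambda>p. fst p * snd p * ?\<beta> p"] by simp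
    also have "(\<Sum>p \<in> ?S - {(i, j)}. fst p * snd p * ?\<beta> p) = (\<Sum>p \<in> ?S - {(i, j)}. fst p * snd p * \<beta> p)"
      by (rule sum.cong) auto
    also have "i * j * Suc (\<beta> (i, j)) + \<dots> = i * j + (\<Sum>p \<in> ?S. fst p * snd p * \<beta> p)"
      using sum.remove[OF S, of "\<lambda>p. fst p * snd p * \<beta> p"] by simp
    finally show ?thesis
      by (simp only: size[OF fin equalityD1[OF supp]] size[OF fin subset_insertI])
  qed
  then show ?thesis
    unfolding depth2_partition_def zero supp by (auto simp del: fun_upd_apply)
qed

definition depth2_weight_sum :: "(nat \<Rightarrow> rat_mpoly) \<Rightarrow> nat \<Rightarrow> rat_mpoly"
  where "depth2_weight_sum y n = (\<Sum>\<beta> | depth2_partition n \<beta>. depth2_weight y \<beta>)"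

lemma depth2_weight_sum_0: "depth2_weight_sum y 0 = 1"
proof -
  have "depth2_partition 0 \<beta> \<longleftrightarrow> \<beta> = (\<lambda>p. 0)" for \<beta>
  proof
    assume \<beta>: "depth2_partition 0 \<beta>"
    have "\<beta> (i, j) = 0" for i j
      using depth2_partition_le(3)[OF \<beta>, of i j] by (cases "\<beta> (i, j) = 0") simp_all
    then show "\<beta> = (\<lambda>p. 0)"
      by auto
  qed (simp add: depth2_partition_def)
  then show ?thesis
    by (simp add: depth2_weight_sum_def depth2_weight_def)
qed

text \<open>Write the factor \<open>N + 1\<close> as the sum of \<open>i * j * \<beta> (i, j)\<close> over the support of \<open>\<beta>\<close>, and lower the entry
  \<open>\<beta> (i, j)\<close> by one. Every depth 2 partition of \<open>N + 1 - i * j\<close> arises once, with the factor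
  \<open>i * y (i * j)\<close>; for fixed \<open>i * j = m + 1\<close> these factors add up to a divisor sum. This is the
  recurrence that the normalised count of commuting pairs satisfies.\<close>

lemma depth2_weight_sum_rec:
  "of_nat (Suc N) * depth2_weight_sum y (Suc N)
    = (\<Sum>m\<le>N. of_nat (\<Sum>i | i dvd Suc m. i) * y (Suc m) * depth2_weight_sum y (N - m))"
proof -
  let ?D = "\<lambda>n. {\<beta>. depth2_partition n \<beta>}"
  let ?S = "SIGMA \<beta>:?D (Suc N). {p. \<beta> p \<noteq> 0}"
  let ?T = "SIGMA m:{..N}. {i. i dvd Suc m} \<times> ?D (N - m)"
  \<comment> \<open>the index \<open>m\<close> stands for \<open>i * j = m + 1\<close>, so \<open>j\<close> is recovered as \<open>Suc m div i\<close>\<close>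
  let ?remove = "\<lambda>(\<beta>, (i, j)). (i * j - 1, i, \<beta>((i, j) := \<beta> (i, j) - 1))"
  let ?insert = "\<lambda>(m, i, \<beta>). let p = (i, Suc m div i) in (\<beta>(p := Suc (\<beta> p)), p)"
  have finD: "finite (?D n)" for n
    by (rule finite_depth2_partitions)
  have supp: "finite {p. \<beta> p \<noteq> 0}" if "depth2_partition n \<beta>" for n \<beta>
    using that by (simp add: depth2_partition_def)
  have "of_nat (Suc N) * depth2_weight_sum y (Suc N)
      = (\<Sum>\<beta>\<in>?D (Suc N). \<Sum>p | \<beta> p \<noteq> 0. of_nat (fst p * snd p * \<beta> p) * depth2_weight y \<beta>)"
    unfolding depth2_weight_sum_def sum_distrib_left
  proof (rule sum.cong[OF refl])
    fix \<beta>
    assume "\<beta> \<in> ?D (Suc N)"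
    then have "(\<Sum>(i, j) | \<beta> (i, j) \<noteq> 0. i * j * \<beta> (i, j)) = Suc N"
      by (simp add: depth2_partition_def)
    moreover have "(\<Sum>(i, j) | \<beta> (i, j) \<noteq> 0. i * j * \<beta> (i, j)) = (\<Sum>p | \<beta> p \<noteq> 0. fst p * snd p * \<beta> p)"
      by (rule sum.cong) auto
    ultimately have "(\<Sum>p | \<beta> p \<noteq> 0. fst p * snd p * \<beta> p) = Suc N"
      by (simp only:)
    then have "of_nat (Suc N) = (\<Sum>p | \<beta> p \<noteq> 0. of_nat (fst p * snd p * \<beta> p) :: rat_mpoly)"
      using of_nat_sum[of "\<lambda>p. fst p * snd p * \<beta> p" "{p. \<beta> p \<noteq> 0}"] by (simp only:)
    then show "of_nat (Suc N) * depth2_weight y \<beta>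
        = (\<Sum>p | \<beta> p \<noteq> 0. of_nat (fst p * snd p * \<beta> p) * depth2_weight y \<beta>)"
      by (simp only: sum_distrib_right)
  qed
  also have "\<dots> = (\<Sum>(\<beta>, p)\<in>?S. of_nat (fst p * snd p * \<beta> p) * depth2_weight y \<beta>)"
    by (rule sum.Sigma) (use finD supp in blast)+
  also have "\<dots> = (\<Sum>(m, i, \<beta>)\<in>?T. of_nat i * y (Suc m) * depth2_weight y \<beta>)"
  proof (rule sum.reindex_bij_witness[of _ ?insert ?remove])
    fix b
    assume "b \<in> ?S"
    then obtain \<beta> i j where b: "b = (\<beta>, (i, j))" and \<beta>: "depth2_partition (Suc N) \<beta>" and nz: "\<beta> (i, j) \<noteq> 0"
      by auto
    let ?\<beta> = "\<beta>((i, j) := \<beta> (i, j) - 1)"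
    have pos: "0 < i" "0 < j"
      using \<beta> nz unfolding depth2_partition_def by (metis neq0_conv)+
    then have ij: "Suc (i * j - 1) = i * j"
      by simp
    have \<beta>_eq: "?\<beta>((i, j) := Suc (?\<beta> (i, j))) = \<beta>"
      using nz by (auto simp: fun_eq_iff)
    have le: "i * j \<le> Suc N"
    proof -
      have "i * j * \<beta> (i, j) \<le> (\<Sum>(i, j) | \<beta> (i, j) \<noteq> 0. i * j * \<beta> (i, j))"
        using member_le_sum[of "(i, j)" "{(i, j). \<beta> (i, j) \<noteq> 0}" "\<lambda>(i, j). i * j * \<beta> (i, j)"] supp[OF \<beta>] nz
        by (simp add: case_prod_unfold)
      also have "\<dots> = Suc N"
        using \<beta> by (simp add: depth2_partition_def)
      finally show ?thesis
        using nz by (metis One_nat_def Suc_leI le_trans mult.right_neutral mult_le_mono2 neq0_conv)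
    qed
    have "depth2_partition (Suc N - i * j) ?\<beta>"
      using depth2_partition_increment_iff[OF pos, of "Suc N - i * j" ?\<beta>] \<beta> le unfolding \<beta>_eq by simp
    moreover have "Suc N - i * j = N - (i * j - 1)" "i * j - 1 \<le> N"
      using ij le by linarith+
    ultimately show "?remove b \<in> ?T"
      using ij by (simp add: b)
    show "?insert (?remove b) = b"
      using \<beta>_eq pos ij by (simp add: b Let_def)
    have "of_nat (i * j * \<beta> (i, j)) * depth2_weight y \<beta> = of_nat i * y (i * j) * depth2_weight y ?\<beta>"
      using depth2_weight_increment[of ?\<beta> j i y] supp[OF \<open>depth2_partition (Suc N - i * j) ?\<beta>\<close>] pos nz
      unfolding \<beta>_eq by simp
    from this[symmetric] show "(case ?remove b of (m, i, \<beta>) \<Rightarrow> of_nat i * y (Suc m) * depth2_weight y \<beta>)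
        = (case b of (\<beta>, p) \<Rightarrow> of_nat (fst p * snd p * \<beta> p) * depth2_weight y \<beta>)"
      by (simp only: b split_conv fst_conv snd_conv ij)
  next
    fix t
    assume "t \<in> ?T"
    then obtain m i \<beta> where t: "t = (m, i, \<beta>)" and m: "m \<le> N" "i dvd Suc m" and \<beta>: "depth2_partition (N - m) \<beta>"
      by auto
    let ?j = "Suc m div i"
    have ij: "i * ?j = Suc m"
      using m(2) by simp
    then have pos: "0 < i" "0 < ?j"
      by (metis Suc_neq_Zero mult_0 mult_0_right neq0_conv)+
    have "N - m + i * ?j = Suc N"
      using ij m(1) by simp
    then have "depth2_partition (Suc N) (\<beta>((i, ?j) := Suc (\<beta> (i, ?j))))"
      using depth2_partition_increment_iff[OF pos, of "N - m" \<beta>] \<beta> by simp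
    then show "?insert t \<in> ?S"
      by (simp add: t Let_def)
    show "?remove (?insert t) = t"
      using ij by (simp add: t Let_def)
  qed
  also have "\<dots> = (\<Sum>m\<le>N. \<Sum>(i, \<beta>)\<in>{i. i dvd Suc m} \<times> ?D (N - m). of_nat i * y (Suc m) * depth2_weight y \<beta>)"
    by (rule sum.Sigma[symmetric]) (simp_all add: finD)
  also have "\<dots> = (\<Sum>m\<le>N. of_nat (\<Sum>i | i dvd Suc m. i) * y (Suc m) * depth2_weight_sum y (N - m))"
    by (simp add: sum.cartesian_product[symmetric] depth2_weight_sum_def sum_distrib_left[symmetric]
        sum_distrib_right[symmetric])
  finally show ?thesis .
qed

section \<open>Sums over conjugacy classes and centralizers\<close>

context group
begin

lemma conj_conj:
  assumes "x \<in> carrier G" "z \<in> carrier G" "g \<in> carrier G"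
  shows "z \<otimes> (x \<otimes> g \<otimes> inv x) \<otimes> inv z = (z \<otimes> x) \<otimes> g \<otimes> inv (z \<otimes> x)"
  using assms by (simp add: m_assoc inv_mult_group)

lemma conj_class_closed: "g \<in> carrier G \<Longrightarrow> conj_class G g \<subseteq> carrier G"
  by (auto simp: conj_class_def)

lemma conj_class_eq:
  assumes "g \<in> carrier G" "z \<in> conj_class G g"
  shows "conj_class G z = conj_class G g"
proof -
  have sub: "conj_class G z \<subseteq> conj_class G g" if "g \<in> carrier G" "z \<in> conj_class G g" for g z
    using that by (auto simp: conj_class_def conj_conj)
  obtain x where x: "x \<in> carrier G" "z = x \<otimes> g \<otimes> inv x"
    using assms(2) by (auto simp: conj_class_def)
  have "inv x \<otimes> z \<otimes> inv (inv x) = g"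
    unfolding x(2) using x(1) assms(1) by (subst conj_conj) simp_all
  then have "g \<in> conj_class G z"
    using x(1) unfolding conj_class_def by (metis (mono_tags, lifting) inv_closed mem_Collect_eq)
  moreover have "z \<in> carrier G"
    using x assms(1) by simp
  ultimately show ?thesis
    using sub assms by blast
qed

lemma partition_on_conj_classes: "partition_on (carrier G) (conj_classes G)"
proof (rule partition_onI)
  have self: "g \<in> conj_class G g" if "g \<in> carrier G" for g
    unfolding conj_class_def using that by (intro CollectI exI[of _ \<one>]) simp
  then show "\<Union>(conj_classes G) = carrier G" "{} \<notin> conj_classes G"
    using conj_class_closed by (fastforce simp: conj_classes_def)+
  show "disjnt p q" if pq: "p \<in> conj_classes G" "q \<in> conj_classes G" "p \<noteq> q" for p q
  proof -
    obtain g g' where "g \<in> carrier G" "p = conj_class G g" "g' \<in> carrier G" "q = conj_class G g'"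
      using pq by (auto simp: conj_classes_def)
    then show ?thesis
      using conj_class_eq pq(3) unfolding disjnt_iff by metis
  qed
qed

text \<open>Conjugation by \<open>x\<close> maps the centralizer of \<open>g\<close> bijectively to that of the conjugate of \<open>g\<close>.\<close>

lemma sum_centralizer_conj:
  assumes inv: "\<And>x h. x \<in> carrier G \<Longrightarrow> h \<in> centralizer G g
      \<Longrightarrow> f (x \<otimes> g \<otimes> inv x) (x \<otimes> h \<otimes> inv x) = f g h"
    and "g \<in> carrier G" "x \<in> carrier G"
  shows "(\<Sum>h \<in> centralizer G (x \<otimes> g \<otimes> inv x). f (x \<otimes> g \<otimes> inv x) h) = (\<Sum>h \<in> centralizer G g. f g h)"
proof -
  have conj_mult: "(z \<otimes> a \<otimes> inv z) \<otimes> (z \<otimes> b \<otimes> inv z) = z \<otimes> (a \<otimes> b) \<otimes> inv z"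
    if "z \<in> carrier G" "a \<in> carrier G" "b \<in> carrier G" for z a b
  proof -
    have "inv z \<otimes> (z \<otimes> w) = w" if "w \<in> carrier G" for w
      using that \<open>z \<in> carrier G\<close> by (simp add: m_assoc[symmetric])
    then show ?thesis
      using that by (simp add: m_assoc)
  qed
  have closed: "z \<otimes> h \<otimes> inv z \<in> centralizer G (z \<otimes> g \<otimes> inv z)"
    if "z \<in> carrier G" "g \<in> carrier G" "h \<in> centralizer G g" for z g h
    using that by (simp add: centralizer_def conj_mult)
  have cancel: "inv x \<otimes> (x \<otimes> h \<otimes> inv x) \<otimes> inv (inv x) = h" if "h \<in> carrier G" for h
    using assms(3) that by (subst conj_conj) simp_all
  have cancel': "x \<otimes> (inv x \<otimes> h \<otimes> inv (inv x)) \<otimes> inv x = h" if "h \<in> carrier G" for h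
    using assms(3) that by (subst conj_conj) simp_all
  show ?thesis
  proof (rule sum.reindex_bij_witness[of _ "\<lambda>h. x \<otimes> h \<otimes> inv x" "\<lambda>h. inv x \<otimes> h \<otimes> inv (inv x)"])
    fix h
    assume h: "h \<in> centralizer G (x \<otimes> g \<otimes> inv x)"
    then have hc: "h \<in> carrier G"
      by (simp add: centralizer_def)
    show "x \<otimes> (inv x \<otimes> h \<otimes> inv (inv x)) \<otimes> inv x = h"
      using hc by (rule cancel')
    show h': "inv x \<otimes> h \<otimes> inv (inv x) \<in> centralizer G g"
      using closed[of "inv x" _ h, OF _ _ h] assms(2,3) cancel[OF assms(2)] by simp
    show "f g (inv x \<otimes> h \<otimes> inv (inv x)) = f (x \<otimes> g \<otimes> inv x) h"
      using inv[OF assms(3) h'] cancel'[OF hc] by simp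
  next
    fix h
    assume h: "h \<in> centralizer G g"
    then show "inv x \<otimes> (x \<otimes> h \<otimes> inv x) \<otimes> inv (inv x) = h"
      by (intro cancel) (simp add: centralizer_def)
    show "x \<otimes> h \<otimes> inv x \<in> centralizer G (x \<otimes> g \<otimes> inv x)"
      using assms(3,2) h by (rule closed)
  qed
qed

text \<open>The inner sum over the centralizer of \<open>g\<close> is a class function of \<open>g\<close>. So \<open>card c\<close> times its value at
  the representative is its sum over the class \<open>c\<close>, whatever the representative, and the classes
  partition the group.\<close>

lemma sum_class_centralizer_pairs:
  fixes f :: "'a \<Rightarrow> 'a \<Rightarrow> 'r::comm_semiring_1"
  assumes fin: "finite (carrier G)" and rep: "class_representatives G rep"
    and inv: "\<And>x g h. x \<in> carrier G \<Longrightarrow> g \<in> carrier G \<Longrightarrow> h \<in> centralizer G g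
      \<Longrightarrow> f (x \<otimes> g \<otimes> inv x) (x \<otimes> h \<otimes> inv x) = f g h"
  shows "(\<Sum>(c, h) \<in> class_centralizer_pairs G rep. of_nat (card c) * f (rep c) h)
    = (\<Sum>g \<in> carrier G. \<Sum>h \<in> centralizer G g. f g h)"
proof -
  let ?\<phi> = "\<lambda>g. \<Sum>h \<in> centralizer G g. f g h"
  have finZ: "finite (centralizer G g)" for g
    using fin by (simp add: centralizer_def)
  have finC: "finite (conj_classes G)"
    using fin by (simp add: conj_classes_def)
  note part = partition_on_conj_classes
  have class_fun: "?\<phi> z = ?\<phi> g" if "g \<in> carrier G" "z \<in> conj_class G g" for g z
    using that sum_centralizer_conj[of g f] inv by (auto simp: conj_class_def)
  have "(\<Sum>(c, h) \<in> class_centralizer_pairs G rep. of_nat (card c) * f (rep c) h)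
      = (\<Sum>c \<in> conj_classes G. of_nat (card c) * ?\<phi> (rep c))"
    unfolding class_centralizer_pairs_def sum_distrib_left
    by (rule sum.Sigma[symmetric]) (simp_all add: finC finZ)
  also have "\<dots> = (\<Sum>c \<in> conj_classes G. \<Sum>g \<in> c. ?\<phi> g)"
  proof (rule sum.cong[OF refl])
    fix c
    assume c: "c \<in> conj_classes G"
    then obtain g where g: "g \<in> carrier G" "c = conj_class G g"
      by (auto simp: conj_classes_def)
    have "rep c \<in> c"
      using rep c by (simp add: class_representatives_def)
    then have "?\<phi> z = ?\<phi> (rep c)" if "z \<in> c" for z
      using class_fun[OF g(1)] that g(2) by metis
    then have "(\<Sum>z \<in> c. ?\<phi> z) = (\<Sum>z \<in> c. ?\<phi> (rep c))"
      by (rule sum.cong[OF refl])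
    then show "of_nat (card c) * ?\<phi> (rep c) = (\<Sum>z \<in> c. ?\<phi> z)"
      by simp
  qed
  also have "\<dots> = (\<Sum>g \<in> \<Union>(conj_classes G). ?\<phi> g)"
  proof (rule sum.Union_disjoint[symmetric, unfolded comp_def])
    show "\<forall>c\<in>conj_classes G. finite c"
      by (auto simp: conj_classes_def intro: finite_subset[OF conj_class_closed fin])
    show "\<forall>c\<in>conj_classes G. \<forall>d\<in>conj_classes G. c \<noteq> d \<longrightarrow> c \<inter> d = {}"
      using part by (auto simp: partition_on_def disjoint_def)
  qed
  also have "\<Union>(conj_classes G) = carrier G"
    using part by (simp add: partition_on_def)
  finally show ?thesis .
qed

end

section \<open>The orbicycle index polynomial of the symmetric group\<close>

lemma joint_orbit_conj:
  assumes "inj x"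
  shows "joint_orbit (x \<circ> g \<circ> inv' x) (x \<circ> h \<circ> inv' x) (x a) = x ` joint_orbit g h a"
proof -
  have pow: "((x \<circ> f \<circ> inv' x) ^^ k) (x b) = x ((f ^^ k) b)" for f k b
    using assms by (induction k) simp_all
  show ?thesis
    by (auto simp: joint_orbit_def pow)
qed

text \<open>Simultaneous conjugation by \<open>x\<close> moves the orbits by \<open>x\<close> and keeps their sizes.\<close>

lemma orbit_weight_conj:
  assumes "x permutes A"
  shows "orbit_weight y A (x \<circ> g \<circ> inv' x) (x \<circ> h \<circ> inv' x) = orbit_weight y A g h"
proof -
  have inj: "inj x"
    using assms by (rule permutes_inj)
  have "joint_orbit (x \<circ> g \<circ> inv' x) (x \<circ> h \<circ> inv' x) ` A
      = joint_orbit (x \<circ> g \<circ> inv' x) (x \<circ> h \<circ> inv' x) ` (x ` A)"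
    using permutes_image[OF assms] by simp
  also have "\<dots> = (\<lambda>B. x ` B) ` (joint_orbit g h ` A)"
    by (simp only: image_image joint_orbit_conj[OF inj])
  finally have img: "joint_orbit (x \<circ> g \<circ> inv' x) (x \<circ> h \<circ> inv' x) ` A
      = (\<lambda>B. x ` B) ` (joint_orbit g h ` A)" .
  have "inj_on (\<lambda>B. x ` B) (joint_orbit g h ` A)"
    using inj by (simp add: inj_on_def inj_image_eq_iff)
  moreover have "card (x ` B) = card B" for B
    using inj by (simp add: card_image inj_on_subset)
  ultimately show ?thesis
    unfolding orbit_weight_def img by (simp add: prod.reindex)
qed

lemma prod_num_blocks:
  fixes y :: "nat \<Rightarrow> 'r::comm_semiring_1"
  assumes "finite P" "card ` P \<subseteq> K" "finite K"
  shows "(\<Prod>k\<in>K. y k ^ num_blocks k P) = (\<Prod>B\<in>P. y (card B))"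
proof -
  have "(\<Prod>B\<in>P. y (card B)) = (\<Prod>k\<in>K. \<Prod>B\<in>{B\<in>P. card B = k}. y (card B))"
    using assms by (intro prod.group[symmetric])
  also have "\<dots> = (\<Prod>k\<in>K. y k ^ num_blocks k P)"
    by (rule prod.cong) (simp_all add: num_blocks_def)
  finally show ?thesis by simp
qed

lemma prod_blocks_partition_join:
  assumes "(g, h) \<in> commuting_perms {1..n}"
  shows "(\<Prod>k \<in> {1..n}. y k ^ num_blocks k
      (partition_join {1..n} (cycle_partition n g) (cycle_partition n h))) = orbit_weight y {1..n} g h"
  unfolding partition_join_cycle_partitions[OF assms] orbit_weight_def
proof (rule prod_num_blocks)
  have "card B \<in> {1..n}" if "B \<subseteq> {1..n}" "B \<noteq> {}" for B
    using that card_mono[of "{1..n}" B] finite_subset[OF that(1)] by (simp add: Suc_le_eq card_gt_0_iff)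
  moreover have "joint_orbit g h a \<noteq> {}" for a
    using joint_orbit_self[of a g h] by blast
  ultimately have "card (joint_orbit g h a) \<in> {1..n}" if "a \<in> {1..n}" for a
    using joint_orbit_subset[OF assms that] by metis
  then show "card ` (joint_orbit g h ` {1..n}) \<subseteq> {1..n}"
    unfolding image_image by (rule image_subsetI)
qed simp_all

lemma orbicycle_index_sym_group:
  assumes "class_representatives (sym_group n) rep"
  shows "orbicycle_index n (sym_group n) rep
    = mpoly_const (1 / fact n) * commuting_weight_sum mpoly_var {1..n}"
proof -
  interpret group "sym_group n"
    by (rule sym_group_is_group)
  let ?G = "sym_group n" and ?A = "{1..n}"
  let ?w = "orbit_weight mpoly_var ?A"
  have cp: "(g, h) \<in> commuting_perms ?A \<longleftrightarrow> g \<in> carrier ?G \<and> h \<in> centralizer ?G g" for g h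
    by (auto simp: commuting_perms_def centralizer_def sym_group_carrier sym_group_mult)
  have fin: "finite (carrier ?G)"
    by (simp add: sym_group_def finite_permutations)
  have "orbicycle_index n ?G rep = mpoly_const (1 / fact n)
      * (\<Sum>(c, h) \<in> class_centralizer_pairs ?G rep. of_nat (card c) * ?w (rep c) h)"
  proof -
    have "(rep c, h) \<in> commuting_perms ?A" if "(c, h) \<in> class_centralizer_pairs ?G rep" for c h
    proof -
      have c: "c \<in> conj_classes ?G" "h \<in> centralizer ?G (rep c)"
        using that by (auto simp: class_centralizer_pairs_def)
      then have "rep c \<in> c" "c \<subseteq> carrier ?G"
        using assms partition_on_conj_classes by (auto simp: class_representatives_def partition_on_def)
      then show ?thesis
        unfolding cp using c(2) by blast
    qed
    then have "(\<Sum>(c, h) \<in> class_centralizer_pairs ?G rep. mpoly_const (of_nat (card c)) *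
        (\<Prod>k \<in> ?A. mpoly_var k ^ num_blocks k
          (partition_join ?A (cycle_partition n (rep c)) (cycle_partition n h))))
      = (\<Sum>(c, h) \<in> class_centralizer_pairs ?G rep. of_nat (card c) * ?w (rep c) h)"
      by (intro sum.cong[OF refl]) (auto simp only: prod_blocks_partition_join mpoly_const_of_nat split_conv)
    moreover have "order ?G = fact n"
      by (simp add: order_def sym_group_card_carrier)
    ultimately show ?thesis
      by (simp add: orbicycle_index_def)
  qed
  also have "(\<Sum>(c, h) \<in> class_centralizer_pairs ?G rep. of_nat (card c) * ?w (rep c) h)
      = (\<Sum>g \<in> carrier ?G. \<Sum>h \<in> centralizer ?G g. ?w g h)"
    using fin assms
  proof (rule sum_class_centralizer_pairs)
    fix x g h
    assume "x \<in> carrier ?G"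
    then show "?w (x \<otimes>\<^bsub>?G\<^esub> g \<otimes>\<^bsub>?G\<^esub> inv\<^bsub>?G\<^esub> x) (x \<otimes>\<^bsub>?G\<^esub> h \<otimes>\<^bsub>?G\<^esub> inv\<^bsub>?G\<^esub> x) = ?w g h"
      using orbit_weight_conj[of x ?A] by (simp add: sym_group_mult sym_group_inv_equality sym_group_carrier del: One_nat_def)
  qed
  also have "\<dots> = (\<Sum>(g, h) \<in> (SIGMA g:carrier ?G. centralizer ?G g). ?w g h)"
    using fin by (intro sum.Sigma) (auto simp: centralizer_def)
  also have "(SIGMA g:carrier ?G. centralizer ?G g) = commuting_perms ?A"
    using cp by auto
  finally show ?thesis
    by (simp add: commuting_weight_sum_def)
qed

text \<open>The product over \<open>j\<close> up to \<open>\<alpha>\<^sub>i\<close> misses no entry, since \<open>\<beta> (i, j) \<noteq> 0\<close> implies \<open>j \<le> \<alpha>\<^sub>i\<close>, and zero entries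
  contribute the factor 1. A divisor \<open>d\<close> of \<open>k\<close> is the pair \<open>(d, k div d)\<close> of product \<open>k\<close>, so both sides
  collect the same orbit sizes.\<close>

lemma depth2_weight_expand:
  assumes \<beta>: "depth2_partition n \<beta>"
  shows "mpoly_const (\<Prod>i \<in> {1..n}. \<Prod>j \<in> {1..depth2_alpha \<beta> i}.
                1 / (of_nat j ^ \<beta> (i, j) * fact (\<beta> (i, j)))) *
       (\<Prod>k \<in> {1..n}. y k ^ (\<Sum>d | d dvd k. \<beta> (d, k div d))) = depth2_weight y \<beta>"
proof -
  let ?S = "{p. \<beta> p \<noteq> 0}"
  let ?c = "\<lambda>p. 1 / (of_nat (snd p) ^ \<beta> p * fact (\<beta> p)) :: rat"
  have fin: "finite ?S" and size: "(\<Sum>(i, j) | \<beta> (i, j) \<noteq> 0. i * j * \<beta> (i, j)) = n"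
    and zero: "\<And>i j. i = 0 \<or> j = 0 \<Longrightarrow> \<beta> (i, j) = 0"
    using \<beta> by (auto simp: depth2_partition_def)
  have bounds: "1 \<le> i" "1 \<le> j" "i \<le> n" "i * j \<le> n" "j \<le> depth2_alpha \<beta> i" if nz: "\<beta> (i, j) \<noteq> 0" for i j
  proof -
    show pos: "1 \<le> i" "1 \<le> j"
      using zero[of i j] nz by (cases i; cases j; simp)+
    show "i \<le> n"
      using depth2_partition_le(1)[OF \<beta> nz] .
    have b: "1 \<le> \<beta> (i, j)"
      using nz by simp
    have "i * j * 1 \<le> i * j * \<beta> (i, j)"
      using b by (rule mult_le_mono2)
    also have "\<dots> \<le> n"
      using member_le_sum[of "(i, j)" "{(i, j). \<beta> (i, j) \<noteq> 0}" "\<lambda>(i, j). i * j * \<beta> (i, j)"] fin nz size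
      by (simp add: case_prod_unfold)
    finally show "i * j \<le> n"
      by simp
    have "finite {j. j \<ge> 1 \<and> \<beta> (i, j) \<noteq> 0}"
      by (rule finite_subset[of _ "snd ` ?S"]) (force, use fin in simp)
    then have "j * \<beta> (i, j) \<le> depth2_alpha \<beta> i"
      unfolding depth2_alpha_def using nz pos by (intro member_le_sum) auto
    moreover have "j * 1 \<le> j * \<beta> (i, j)"
      using b by (rule mult_le_mono2)
    ultimately show "j \<le> depth2_alpha \<beta> i"
      by (simp only: mult_1_right)
  qed
  have "(\<Prod>i \<in> {1..n}. \<Prod>j \<in> {1..depth2_alpha \<beta> i}. 1 / (of_nat j ^ \<beta> (i, j) * fact (\<beta> (i, j))))
      = (\<Prod>(i, j) \<in> (SIGMA i:{1..n}. {1..depth2_alpha \<beta> i}). ?c (i, j))"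
    by (simp add: prod.Sigma)
  also have "\<dots> = (\<Prod>p\<in>?S. ?c p)"
  proof (rule prod.mono_neutral_cong_right)
    show "?S \<subseteq> (SIGMA i:{1..n}. {1..depth2_alpha \<beta> i})"
      using bounds by auto
    show "\<forall>p \<in> (SIGMA i:{1..n}. {1..depth2_alpha \<beta> i}) - ?S. (case p of (i, j) \<Rightarrow> ?c (i, j)) = 1"
      by (simp add: split_def)
  qed auto
  finally have C: "(\<Prod>i \<in> {1..n}. \<Prod>j \<in> {1..depth2_alpha \<beta> i}. 1 / (of_nat j ^ \<beta> (i, j) * fact (\<beta> (i, j))))
      = (\<Prod>p\<in>?S. ?c p)" .
  let ?T = "SIGMA k:{1..n}. {d. d dvd k}"
  have "(\<Prod>k \<in> {1..n}. y k ^ (\<Sum>d | d dvd k. \<beta> (d, k div d)))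
      = (\<Prod>k \<in> {1..n}. \<Prod>d | d dvd k. y k ^ \<beta> (d, k div d))"
    by (simp add: power_sum)
  also have "\<dots> = (\<Prod>(k, d) \<in> ?T. y k ^ \<beta> (d, k div d))"
    by (rule prod.Sigma) (auto simp: finite_divisors_nat)
  also have "\<dots> = (\<Prod>p \<in> (\<lambda>(k, d). (d, k div d)) ` ?T. y (fst p * snd p) ^ \<beta> p)"
  proof (subst prod.reindex)
    show "inj_on (\<lambda>(k, d). (d, k div d)) ?T"
      by (auto simp: inj_on_def)
  qed (auto intro!: prod.cong)
  also have "\<dots> = (\<Prod>p\<in>?S. y (fst p * snd p) ^ \<beta> p)"
  proof (rule prod.mono_neutral_right)
    show "finite ((\<lambda>(k, d). (d, k div d)) ` ?T)"
      by (intro finite_imageI finite_SigmaI) (auto simp: finite_divisors_nat)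
    show "?S \<subseteq> (\<lambda>(k, d). (d, k div d)) ` ?T"
    proof
      fix p
      assume "p \<in> ?S"
      then obtain i j where p: "p = (i, j)" "\<beta> (i, j) \<noteq> 0"
        by (cases p) auto
      note b = bounds[OF p(2)]
      have "(i * j, i) \<in> ?T"
        using b by (auto simp: Suc_le_eq)
      moreover have "(i, j) = (\<lambda>(k, d). (d, k div d)) (i * j, i)"
        using b by simp
      ultimately show "p \<in> (\<lambda>(k, d). (d, k div d)) ` ?T"
        unfolding p(1) by (rule rev_image_eqI)
    qed
  qed auto
  finally have Y: "(\<Prod>k \<in> {1..n}. y k ^ (\<Sum>d | d dvd k. \<beta> (d, k div d)))
      = (\<Prod>p\<in>?S. y (fst p * snd p) ^ \<beta> p)" .
  show ?thesis
    unfolding C Y depth2_weight_def mpoly_const_prod prod.distrib[symmetric]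
    by (rule prod.cong) (auto simp: entry_weight_def)
qed

theorem theorem9:
  fixes n :: nat and rep :: "(nat \<Rightarrow> nat) set \<Rightarrow> (nat \<Rightarrow> nat)"
  assumes "n \<ge> 1"
    and "class_representatives (sym_group n) rep"
  shows "orbicycle_index n (sym_group n) rep =
    (\<Sum>\<beta> | depth2_partition n \<beta>.
       mpoly_const (\<Prod>i \<in> {1..n}. \<Prod>j \<in> {1..depth2_alpha \<beta> i}.
                1 / (of_nat j ^ \<beta> (i, j) * fact (\<beta> (i, j)))) *
       (\<Prod>k \<in> {1..n}. mpoly_var k ^ (\<Sum>d | d dvd k. \<beta> (d, k div d))))"
proof -
  have "commuting_weight_sum mpoly_var {1..n} = of_nat (fact n) * depth2_weight_sum mpoly_var n"
    using commuting_weight_sum_eq[of "depth2_weight_sum mpoly_var" mpoly_var "{1..n}",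
        OF depth2_weight_sum_0 depth2_weight_sum_rec] by simp
  also have "of_nat (fact n) = mpoly_const (fact n)"
    by (simp only: mpoly_const_of_nat[symmetric] of_nat_fact)
  finally have "orbicycle_index n (sym_group n) rep
      = mpoly_const (1 / fact n * fact n) * depth2_weight_sum mpoly_var n"
    unfolding orbicycle_index_sym_group[OF assms(2)] mpoly_const_mult by (simp only: mult.assoc)
  also have "\<dots> = depth2_weight_sum mpoly_var n"
    by (simp add: mpoly_const_1)
  also have "\<dots> = (\<Sum>\<beta> | depth2_partition n \<beta>.
       mpoly_const (\<Prod>i \<in> {1..n}. \<Prod>j \<in> {1..depth2_alpha \<beta> i}.
                1 / (of_nat j ^ \<beta> (i, j) * fact (\<beta> (i, j)))) *
       (\<Prod>k \<in> {1..n}. mpoly_var k ^ (\<Sum>d | d dvd k. \<beta> (d, k div d))))"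
    unfolding depth2_weight_sum_def by (rule sum.cong[OF refl], subst depth2_weight_expand) simp_all
  finally show ?thesis .
qed

end
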